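(* Let $X\subseteq\mathbb{R}^n$ be r.e. open. (a ii) Fix a $(\nu\to\rho^n)$-computable sequence $(\vec x_j)_{j}$ whose set of values is dense in $X$. A function $f:X\to\mathbb{R}^m$ is computable if and only if the real sequence $(f(\vec x_j))_j$ is computable and there is a $(\rho^n\times\nu\rightrightarrows\nu)$-computable multi-valued function $\mathrm{moc}:X\times\mathbb{N}\rightrightarrows\mathbb{N}$ such that $f[B(\vec x,2^{-\ell})\cap X]\subseteq B(f(\vec x),2^{-k})$ for all $\vec x\in X$, $k\in\mathbb{N}$, $\ell\in\mathrm{moc}(\vec x,k)$. (b i) A computable $f:X\to\mathbb{R}^m$ is effectively open if and only if $\mathrm{Moo}_f:X\times\mathbb{N}\to\mathbb{R}$ is strictly positive and $(\rho^n\times\nu\to\rho_<)$-computable. (b ii) Equivalently, a computable $f:X\to\mathbb{R}^m$ is effectively open if and only if there is a $(\rho^n\times\nu\rightrightarrows\nu)$-computable multi-valued function $\mathrm{moo}:X\times\mathbb{N}\rightrightarrows\mathbb{N}$ such that $B(f(\vec x),2^{-\ell})\subseteq f[B(\vec x,2^{-k})\cap X]$ for all $\vec x\in X$, $k\in\mathbb{N}$, $\ell\in\mathrm{moo}(\vec x,k)$.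
   Context: Computability is in the sense of Type-2 Theory of Effectivity (Weihrauch). $\nu$ is the standard notation of $\mathbb{N}$; $\rho^n$ is the Cauchy representation of $\mathbb{R}^n$ (a name is a sequence of rational vectors $\vec q_k$ with $|\vec q_k-\vec x|<2^{-k}$); $\rho_<$ is the representation of $\mathbb{R}$ by sequences of rationals converging from below (lower approximations). $\theta^d_<$ is the representation of open subsets of $\mathbb{R}^d$: a name of $U$ is a list of rational centers and positive rational radii of open Euclidean balls whose union is $U$. $X\subseteq\mathbb{R}^n$ is r.e. open if it has a computable $\theta^n_<$-name. An open function $f:X\to\mathbb{R}^m$ is effectively open if the mapping $U\mapsto f[U]$ on open $U\subseteq X$ is $(\theta^n_<\to\theta^m_<)$-computable. A multi-valued function $h:A\rightrightarrows B$ is $(\delta\rightrightarrows\delta')$-computable if some Type-2 machine, on any $\delta$-name of any $a\in\operatorname{dom}$, outputs a $\delta'$-name of some element of $h(a)$ (the element may depend on the name). $B(\vec x,r)$ is the open Euclidean ball. $\mathrm{Moo}_f(\vec x,k):=\sup\{s\ge0:\overline{B}(f(\vec x),s)\subseteq f[B(\vec x,2^{-k})\cap X]\}$, where $\overline{B}$ denotes the closed ball.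
   Formalization: In (b i), Moo_f is taken with values in the extended reals and ρ_< is extended to the value +∞, since the supremum can be infinite (e.g. f(x)=tan(πx) on X=(-1/2,1/2), x=0, k=0); where Moo_f is finite this is the stated claim. *)

theory Defs
  imports "HOL-Analysis.Analysis" "HOL-Library.Nat_Bijection" "HOL-Library.Countable"
    "HOL-Library.Extended_Real"
begin

inductive recfn :: "nat \<Rightarrow> (nat list \<Rightarrow> nat) \<Rightarrow> bool" where
  zero: "recfn n (\<lambda>_. 0)"
| succ: "recfn 1 (\<lambda>xs. Suc (hd xs))"
| proj: "i < n \<Longrightarrow> recfn n (\<lambda>xs. xs ! i)"
| comp: "recfn k f \<Longrightarrow> length gs = k \<Longrightarrow> (\<forall>g\<in>set gs. recfn n g)
          \<Longrightarrow> recfn n (\<lambda>xs. f (map (\<lambda>g. g xs) gs))"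
| prim: "recfn n f \<Longrightarrow> recfn (Suc (Suc n)) g
          \<Longrightarrow> recfn (Suc n) (\<lambda>xs. rec_nat (f (tl xs)) (\<lambda>y r. g (r # y # tl xs)) (hd xs))"
| mini: "recfn (Suc n) g \<Longrightarrow> (\<forall>xs. length xs = n \<longrightarrow> (\<exists>y. g (y # xs) = 0))
          \<Longrightarrow> recfn n (\<lambda>xs. LEAST y. g (y # xs) = 0)"

definition rec_computable :: "(nat \<Rightarrow> nat) \<Rightarrow> bool" where
  "rec_computable h \<longleftrightarrow> (\<exists>f. recfn 1 f \<and> (\<forall>x. f [x] = h x))"

type_synonym name = "nat \<Rightarrow> nat"

definition pcode :: "name \<Rightarrow> nat \<Rightarrow> nat" where
  "pcode p n = list_encode (map p [0..<n])"

text \<open>The machine described by a total computable h on input p produces output q: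
  h(i, code of prefix of p) = Suc v means "output symbol i is v", 0 means "not yet".\<close>
definition t2_out :: "(nat \<Rightarrow> nat) \<Rightarrow> name \<Rightarrow> name \<Rightarrow> bool" where
  "t2_out h p q \<longleftrightarrow> (\<forall>i. (\<exists>n. h (prod_encode (i, pcode p n)) = Suc (q i)) \<and>
                        (\<forall>n v. h (prod_encode (i, pcode p n)) = Suc v \<longrightarrow> v = q i))"

text \<open>A representation is given as the relation "p is a name of a".\<close>
definition mv_computable ::
  "(name \<Rightarrow> 'a \<Rightarrow> bool) \<Rightarrow> (name \<Rightarrow> 'b \<Rightarrow> bool) \<Rightarrow> 'a set \<Rightarrow> ('a \<Rightarrow> 'b set) \<Rightarrow> bool" where
  "mv_computable \<delta> \<delta>' D H \<longleftrightarrow> (\<exists>h. rec_computable h \<and>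
     (\<forall>a\<in>D. \<forall>p. \<delta> p a \<longrightarrow> (\<exists>q b. t2_out h p q \<and> \<delta>' q b \<and> b \<in> H a)))"

definition fn_computable ::
  "(name \<Rightarrow> 'a \<Rightarrow> bool) \<Rightarrow> (name \<Rightarrow> 'b \<Rightarrow> bool) \<Rightarrow> 'a set \<Rightarrow> ('a \<Rightarrow> 'b) \<Rightarrow> bool" where
  "fn_computable \<delta> \<delta>' D F \<longleftrightarrow> mv_computable \<delta> \<delta>' D (\<lambda>a. {F a})"

definition comp_elem :: "(name \<Rightarrow> 'a \<Rightarrow> bool) \<Rightarrow> 'a \<Rightarrow> bool" where
  "comp_elem \<delta> a \<longleftrightarrow> (\<exists>p. rec_computable p \<and> \<delta> p a)"

definition rat_dec :: "nat \<Rightarrow> real" where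
  "rat_dec c = (case prod_decode c of (a, b) \<Rightarrow> of_int (int_decode a) / of_nat (Suc b))"

text \<open>Rational vectors in R^n, n = CARD('n); coordinates indexed via the injection to_nat.\<close>
definition vec_dec :: "nat \<Rightarrow> real ^ ('n::finite)" where
  "vec_dec c = (\<chi> i. if to_nat i < length (list_decode c)
                     then rat_dec (list_decode c ! to_nat i) else 0)"

definition nu_rep :: "name \<Rightarrow> nat \<Rightarrow> bool" where
  "nu_rep p k \<longleftrightarrow> p 0 = k"

definition rho_rep :: "name \<Rightarrow> real ^ ('n::finite) \<Rightarrow> bool" where
  "rho_rep p x \<longleftrightarrow> (\<forall>k. dist (vec_dec (p k)) x < inverse (2 ^ k))"

text \<open>Lower representation; extended to ereal so that the value +\<infinity> is allowed.\<close>
definition rhol_rep :: "name \<Rightarrow> ereal \<Rightarrow> bool" where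
  "rhol_rep p y \<longleftrightarrow> (\<forall>k. ereal (rat_dec (p k)) < y) \<and> (\<forall>z<y. \<exists>k. z < ereal (rat_dec (p k)))"

definition theta_rep :: "name \<Rightarrow> (real ^ ('n::finite)) set \<Rightarrow> bool" where
  "theta_rep p U \<longleftrightarrow> U = (\<Union>k. if p k = 0 then {}
       else (case prod_decode (p k - 1) of (c, r) \<Rightarrow> ball (vec_dec c) (rat_dec r)))"

definition pair_rep :: "(name \<Rightarrow> 'a \<Rightarrow> bool) \<Rightarrow> (name \<Rightarrow> 'b \<Rightarrow> bool) \<Rightarrow> name \<Rightarrow> 'a \<times> 'b \<Rightarrow> bool" where
  "pair_rep \<delta>1 \<delta>2 p ab \<longleftrightarrow> \<delta>1 (\<lambda>i. p (2 * i)) (fst ab) \<and> \<delta>2 (\<lambda>i. p (2 * i + 1)) (snd ab)"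

definition eff_open :: "(real ^ ('n::finite)) set \<Rightarrow> (real ^ 'n \<Rightarrow> real ^ ('m::finite)) \<Rightarrow> bool" where
  "eff_open X f \<longleftrightarrow> (\<forall>U. open U \<and> U \<subseteq> X \<longrightarrow> open (f ` U)) \<and>
     fn_computable theta_rep theta_rep {U. open U \<and> U \<subseteq> X} (\<lambda>U. f ` U)"

definition Moo :: "(real ^ ('n::finite)) set \<Rightarrow> (real ^ 'n \<Rightarrow> real ^ ('m::finite)) \<Rightarrow> real ^ 'n \<Rightarrow> nat \<Rightarrow> ereal" where
  "Moo X f x k = Sup {ereal s | s. s \<ge> 0 \<and> cball (f x) s \<subseteq> f ` (ball x (inverse (2 ^ k)) \<inter> X)}"

end

theory Submission
  imports Defs
begin

text \<open>Part (a): a machine computing \<open>f\<close> emits the \<open>k\<close>-th symbol after reading a finite prefix of a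
  name of \<open>x\<close>; all points close enough to \<open>x\<close> have a name with that prefix, which bounds the
  oscillation of \<open>f\<close> near \<open>x\<close>. Conversely, a modulus of continuity tells how near to \<open>x\<close> a point of
  the dense sequence must be for its value to serve as an approximation of \<open>f x\<close>.

  Part (b) is a cycle of implications. If \<open>f\<close> is effectively open, a list of balls exhausting
  \<open>f[B(x, 2\<^sup>-\<^sup>k) \<inter> X]\<close> can be computed, and the radii of the closed balls about \<open>f x\<close> covered by it
  are enumerated by compactness. A positive lower approximation of \<open>Moo\<close> yields a modulus of
  openness. Given the latter, \<open>f[U]\<close> is the union of balls about approximations of \<open>f c\<close> for
  rational \<open>c \<in> U\<close>, with radii supplied by the modulus run on suitable names of \<open>c\<close>.\<close>

section \<open>Recursive functions\<close>

text \<open>Every machine built below searches for a finite certificate in the part of the name read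
  so far. The certificates consist of strict inequalities between rationals: these are decidable,
  they show up after finitely many symbols, and their strictness leaves the room that absorbs
  approximation errors. Different names of a point may lead to different certificates, so the moduli
  are multi-valued. The name of \<open>X\<close> enters where a machine for images of open sets is
  to be applied: it makes a list of balls for \<open>B(x, 2^-k) \<inter> X\<close> computable from a
  name of \<open>x\<close>. Closed balls in \<open>Moo\<close> turn inclusion in an open image into
  a fact with a finite certificate, and the strict lower bounds asked for by \<open>rhol_rep\<close>
  leave the extra radius that a grid needs. \<open>Moo\<close> can be infinite, as for
  \<open>tan (\<pi> x / 2)\<close> on \<open>(-1, 1)\<close> at \<open>x = 0\<close>,
  \<open>k = 0\<close>; therefore lower names are names of values in \<open>ereal\<close>.\<close>

text \<open>The functions in \<open>recfn\<close> are fixed on lists of every length, including the junk values of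
  \<open>hd\<close> and \<open>!\<close>; closure properties hold only up to agreement on lists of the right length.\<close>

definition rec_on :: "nat \<Rightarrow> (nat list \<Rightarrow> nat) \<Rightarrow> bool" where
  "rec_on n f \<longleftrightarrow> (\<exists>f'. recfn n f' \<and> (\<forall>xs. length xs = n \<longrightarrow> f' xs = f xs))"

lemma rec_on_cong:
  "rec_on n f \<Longrightarrow> (\<And>xs. length xs = n \<Longrightarrow> f xs = g xs) \<Longrightarrow> rec_on n g"
  unfolding rec_on_def by metis

lemma rec_on_recfn: "recfn n f \<Longrightarrow> rec_on n f"
  unfolding rec_on_def by blast

lemma rec_on_proj: "i < n \<Longrightarrow> rec_on n (\<lambda>xs. xs ! i)"
  by (rule rec_on_recfn) (rule recfn.proj)

lemma rec_on_comp:
  assumes "rec_on k f" "length gs = k" "\<forall>g\<in>set gs. rec_on n g"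
  shows "rec_on n (\<lambda>xs. f (map (\<lambda>g. g xs) gs))"
proof -
  obtain f' where f': "recfn k f'" "\<And>xs. length xs = k \<Longrightarrow> f' xs = f xs"
    using assms(1) unfolding rec_on_def by blast
  obtain G where G: "\<And>g. g \<in> set gs \<Longrightarrow> recfn n (G g)"
    "\<And>g xs. g \<in> set gs \<Longrightarrow> length xs = n \<Longrightarrow> G g xs = g xs"
    using assms(3) unfolding rec_on_def by metis
  have "recfn n (\<lambda>xs. f' (map (\<lambda>g. g xs) (map G gs)))"
    using f'(1) assms(2) G(1) by (intro recfn.comp) auto
  moreover have "f' (map (\<lambda>g. g xs) (map G gs)) = f (map (\<lambda>g. g xs) gs)"
    if "length xs = n" for xs
  proof -
    have "map (\<lambda>g. g xs) (map G gs) = map (\<lambda>g. g xs) gs"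
      using G(2) that by simp
    then show ?thesis using f'(2) assms(2) by (simp del: map_map)
  qed
  ultimately show ?thesis unfolding rec_on_def by blast
qed

lemma rec_on_comp1: "rec_on 1 f \<Longrightarrow> rec_on n g \<Longrightarrow> rec_on n (\<lambda>xs. f [g xs])"
  using rec_on_comp[of 1 f "[g]" n] by simp

lemma rec_on_comp2:
  "rec_on 2 f \<Longrightarrow> rec_on n g \<Longrightarrow> rec_on n h \<Longrightarrow> rec_on n (\<lambda>xs. f [g xs, h xs])"
  using rec_on_comp[of 2 f "[g, h]" n] by simp

lemma rec_on_Suc: "rec_on n g \<Longrightarrow> rec_on n (\<lambda>xs. Suc (g xs))"
  using rec_on_comp1[OF rec_on_recfn[OF recfn.succ], of n g] by simp

lemma rec_on_const: "rec_on n (\<lambda>xs. c)"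
  by (induction c) (auto intro: rec_on_Suc rec_on_recfn recfn.zero)

lemma rec_on_rec:
  assumes "rec_on n f" "rec_on (Suc (Suc n)) g"
  shows "rec_on (Suc n) (\<lambda>xs. rec_nat (f (tl xs)) (\<lambda>y r. g (r # y # tl xs)) (hd xs))"
proof -
  obtain f' g' where *: "recfn n f'" "\<And>xs. length xs = n \<Longrightarrow> f' xs = f xs"
    "recfn (Suc (Suc n)) g'" "\<And>xs. length xs = Suc (Suc n) \<Longrightarrow> g' xs = g xs"
    using assms unfolding rec_on_def by metis
  have "recfn (Suc n) (\<lambda>xs. rec_nat (f' (tl xs)) (\<lambda>y r. g' (r # y # tl xs)) (hd xs))"
    by (intro recfn.prim *)
  moreover have "rec_nat (f' (tl xs)) (\<lambda>y r. g' (r # y # tl xs)) m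
      = rec_nat (f (tl xs)) (\<lambda>y r. g (r # y # tl xs)) m" if "length xs = Suc n" for xs m
    using that by (induction m) (auto simp: *)
  ultimately show ?thesis unfolding rec_on_def by blast
qed

lemma rec_on_Least:
  assumes "rec_on (Suc n) g" "\<And>xs. length xs = n \<Longrightarrow> \<exists>y. g (y # xs) = 0"
  shows "rec_on n (\<lambda>xs. LEAST y. g (y # xs) = 0)"
proof -
  obtain g' where *: "recfn (Suc n) g'" "\<And>xs. length xs = Suc n \<Longrightarrow> g' xs = g xs"
    using assms(1) unfolding rec_on_def by metis
  have "recfn n (\<lambda>xs. LEAST y. g' (y # xs) = 0)"
    using assms(2) * by (intro recfn.mini) auto
  then show ?thesis unfolding rec_on_def using *(2) by (intro exI conjI) auto
qed

lemma length_1_conv: "length xs = Suc 0 \<longleftrightarrow> (\<exists>x. xs = [x])"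
  by (cases xs) auto

lemma length_2_conv: "length xs = 2 \<longleftrightarrow> (\<exists>x y. xs = [x, y])"
  by (cases xs; cases "tl xs") (auto simp: numeral_2_eq_2)

section \<open>Basic arithmetic by primitive recursion\<close>

lemma rec_on_plus: "rec_on 2 (\<lambda>xs. xs ! 0 + xs ! 1)"
proof -
  have "rec_on (Suc 1) (\<lambda>xs. rec_nat (tl xs ! 0) (\<lambda>y r. Suc ((r # y # tl xs) ! 0)) (hd xs))"
    by (intro rec_on_rec rec_on_Suc rec_on_proj) auto
  then have "rec_on 2 (\<lambda>xs. rec_nat (tl xs ! 0) (\<lambda>y r. Suc ((r # y # tl xs) ! 0)) (hd xs))"
    by (simp add: numeral_2_eq_2)
  moreover have "rec_nat b (\<lambda>y r. Suc r) a = a + b" for a b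
    by (induction a) auto
  ultimately show ?thesis
    by (elim rec_on_cong) (auto simp: length_2_conv)
qed

lemma rec_on_add: "rec_on n f \<Longrightarrow> rec_on n g \<Longrightarrow> rec_on n (\<lambda>xs. f xs + g xs)"
  using rec_on_comp2[OF rec_on_plus] by fastforce

lemma rec_on_pred: "rec_on 1 (\<lambda>xs. xs ! 0 - 1)"
proof -
  have "rec_on (Suc 0) (\<lambda>xs. rec_nat 0 (\<lambda>y r. (r # y # tl xs) ! 1) (hd xs))"
    using rec_on_rec[OF rec_on_const[of 0 0] rec_on_proj[of 1 "Suc (Suc 0)"]] by simp
  moreover have "rec_nat 0 (\<lambda>y r. y) a = a - 1" for a :: nat
    by (cases a) auto
  ultimately show ?thesis
    unfolding One_nat_def by (elim rec_on_cong) (auto simp: length_1_conv)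
qed

lemma rec_on_minus: "rec_on 2 (\<lambda>xs. xs ! 1 - xs ! 0)"
proof -
  have "rec_on (Suc 1) (\<lambda>xs. rec_nat (tl xs ! 0) (\<lambda>y r. [(r # y # tl xs) ! 0] ! 0 - 1) (hd xs))"
    by (intro rec_on_rec rec_on_comp1[OF rec_on_pred] rec_on_proj) auto
  then have "rec_on 2 (\<lambda>xs. rec_nat (tl xs ! 0) (\<lambda>y r. [(r # y # tl xs) ! 0] ! 0 - 1) (hd xs))"
    by (simp add: numeral_2_eq_2)
  moreover have "rec_nat b (\<lambda>y r. r - 1) a = b - a" for a b :: nat
    by (induction a) auto
  ultimately show ?thesis
    by (elim rec_on_cong) (auto simp: length_2_conv)
qed

lemma rec_on_diff: "rec_on n f \<Longrightarrow> rec_on n g \<Longrightarrow> rec_on n (\<lambda>xs. f xs - g xs)"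
  using rec_on_comp2[OF rec_on_minus, of n g f] by simp

lemma rec_on_triangle: "rec_on 1 (\<lambda>xs. triangle (xs ! 0))"
proof -
  have "rec_on (Suc 0) (\<lambda>xs. rec_nat 0 (\<lambda>y r. (r # y # tl xs) ! 0 + Suc ((r # y # tl xs) ! 1)) (hd xs))"
    by (intro rec_on_rec rec_on_add rec_on_Suc rec_on_proj rec_on_const) auto
  moreover have "rec_nat 0 (\<lambda>y r. r + Suc y) a = triangle a" for a :: nat
    by (induction a) auto
  ultimately show ?thesis
    unfolding One_nat_def by (elim rec_on_cong) (auto simp: length_1_conv)
qed

lemma rec_on_prod_encode:
  "rec_on n f \<Longrightarrow> rec_on n g \<Longrightarrow> rec_on n (\<lambda>xs. prod_encode (f xs, g xs))"
  using rec_on_add[OF rec_on_comp1[OF rec_on_triangle rec_on_add, of n f g], of f]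
  by (simp add: prod_encode_def)

section \<open>Unary recursive functions and the inverse of the pairing function\<close>

lemma rec_computable_iff: "rec_computable h \<longleftrightarrow> rec_on 1 (\<lambda>xs. h (xs ! 0))"
  unfolding rec_computable_def rec_on_def by (auto simp: length_1_conv)

lemma rec_on_rec_computable: "rec_computable h \<Longrightarrow> rec_on n f \<Longrightarrow> rec_on n (\<lambda>xs. h (f xs))"
  unfolding rec_computable_iff using rec_on_comp1 by fastforce

lemma rec_computable_id: "rec_computable (\<lambda>x. x)"
  unfolding rec_computable_iff by (rule rec_on_proj) simp

lemma rec_computable_const: "rec_computable (\<lambda>x. c)"
  unfolding rec_computable_iff by (rule rec_on_const)

lemma rec_computable_comp: "rec_computable f \<Longrightarrow> rec_computable g \<Longrightarrow> rec_computable (\<lambda>x. f (g x))"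
  unfolding rec_computable_iff[of g] rec_computable_iff[of "\<lambda>x. f (g x)"]
  by (rule rec_on_rec_computable)

lemma rec_computable_add:
  "rec_computable f \<Longrightarrow> rec_computable g \<Longrightarrow> rec_computable (\<lambda>x. f x + g x)"
  unfolding rec_computable_iff by (rule rec_on_add)

lemma rec_computable_diff:
  "rec_computable f \<Longrightarrow> rec_computable g \<Longrightarrow> rec_computable (\<lambda>x. f x - g x)"
  unfolding rec_computable_iff by (rule rec_on_diff)

lemma rec_computable_prod_encode:
  "rec_computable f \<Longrightarrow> rec_computable g \<Longrightarrow> rec_computable (\<lambda>x. prod_encode (f x, g x))"
  unfolding rec_computable_iff by (rule rec_on_prod_encode)

text \<open>The number of the antidiagonal of the Cantor pairing on which \<open>x\<close> lies.
  Truncated subtraction expresses \<open>x < triangle (Suc s)\<close> as an equation with 0, the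
  form in which \<open>recfn\<close> minimises; the search succeeds at \<open>s = x\<close> at the
  latest.\<close>

definition diagonal :: "nat \<Rightarrow> nat" where
  "diagonal x = (LEAST s. Suc x - triangle (Suc s) = 0)"

lemma diagonal_prod_encode: "diagonal (prod_encode (a, b)) = a + b"
  unfolding diagonal_def
proof (rule Least_equality)
  show "Suc (prod_encode (a, b)) - triangle (Suc (a + b)) = 0"
    by (simp add: prod_encode_def)
next
  fix s assume *: "Suc (prod_encode (a, b)) - triangle (Suc s) = 0"
  show "a + b \<le> s"
  proof (rule ccontr)
    assume "\<not> a + b \<le> s"
    then obtain d where "a + b = Suc s + d" using less_iff_Suc_add[of s "a + b"] by auto
    moreover have "triangle (Suc s) \<le> triangle (Suc s + d)"
      by (induction d) auto
    ultimately show False using * by (simp add: prod_encode_def)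
  qed
qed

lemma rec_computable_diagonal: "rec_computable diagonal"
proof -
  have "rec_on 1 (\<lambda>xs. LEAST s. Suc ((s # xs) ! 1) - triangle ([Suc ((s # xs) ! 0)] ! 0) = 0)"
  proof (rule rec_on_Least)
    show "rec_on (Suc 1) (\<lambda>xs. Suc (xs ! 1) - triangle ([Suc (xs ! 0)] ! 0))"
      by (intro rec_on_diff rec_on_Suc rec_on_proj rec_on_comp1[OF rec_on_triangle]) auto
    fix xs :: "nat list"
    show "\<exists>y. Suc ((y # xs) ! 1) - triangle ([Suc ((y # xs) ! 0)] ! 0) = 0"
      by (rule exI[of _ "xs ! 0"]) simp
  qed
  then show ?thesis
    unfolding rec_computable_iff diagonal_def by simp
qed

text \<open>As \<open>prod_encode (a, b) = triangle (a + b) + a\<close>, subtracting the triangular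
  number of the antidiagonal leaves \<open>a\<close>; afterwards \<open>b\<close> is obtained as
  \<open>diagonal x - a\<close>.\<close>

lemma rec_computable_fst: "rec_computable (\<lambda>x. fst (prod_decode x))"
proof -
  have "rec_computable (\<lambda>x. triangle x)"
    unfolding rec_computable_iff by (rule rec_on_triangle)
  from rec_computable_diff[OF rec_computable_id rec_computable_comp[OF this rec_computable_diagonal]]
  have "rec_computable (\<lambda>x. x - triangle (diagonal x))" .
  moreover have "x - triangle (diagonal x) = fst (prod_decode x)" for x
  proof (cases "prod_decode x")
    case (Pair a b)
    then have "x = prod_encode (a, b)" by (metis prod_decode_inverse)
    then show ?thesis using Pair by (simp add: diagonal_prod_encode) (simp add: prod_encode_def)
  qed
  ultimately show ?thesis by simp
qed

lemma rec_computable_snd: "rec_computable (\<lambda>x. snd (prod_decode x))"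
proof -
  have "diagonal x - fst (prod_decode x) = snd (prod_decode x)" for x
    by (metis add_diff_cancel_left' diagonal_prod_encode prod.collapse prod_decode_inverse)
  then show ?thesis
    using rec_computable_diff[OF rec_computable_diagonal rec_computable_fst] by simp
qed

lemma rec_computable_rec_nat:
  assumes "rec_computable f" "rec_computable g" "rec_computable c"
  shows "rec_computable (\<lambda>x. rec_nat (f x) (\<lambda>y r. g (prod_encode (x, prod_encode (y, r)))) (c x))"
proof -
  have "rec_on (Suc 1) (\<lambda>xs. rec_nat (f (tl xs ! 0)) (\<lambda>y r. g (prod_encode ((r # y # tl xs) ! 2,
      prod_encode ((r # y # tl xs) ! 1, (r # y # tl xs) ! 0)))) (hd xs))"
    by (intro rec_on_rec rec_on_rec_computable[OF assms(1)] rec_on_rec_computable[OF assms(2)]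
        rec_on_prod_encode rec_on_proj) auto
  then have *: "rec_on 2 (\<lambda>xs. rec_nat (f (tl xs ! 0)) (\<lambda>y r. g (prod_encode ((r # y # tl xs) ! 2,
      prod_encode ((r # y # tl xs) ! 1, (r # y # tl xs) ! 0)))) (hd xs))"
    by (simp add: numeral_2_eq_2)
  show ?thesis
    using rec_on_comp2[OF * assms(3)[unfolded rec_computable_iff]
        rec_computable_id[unfolded rec_computable_iff]]
    unfolding rec_computable_iff by simp
qed

lemma rec_computable_Least:
  assumes "rec_computable g" "\<And>x. \<exists>y. g (prod_encode (x, y)) = 0"
  shows "rec_computable (\<lambda>x. LEAST y. g (prod_encode (x, y)) = 0)"
proof -
  have "rec_on 1 (\<lambda>xs. LEAST y. g (prod_encode ((y # xs) ! 1, (y # xs) ! 0)) = 0)"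
    using assms(2)
    by (intro rec_on_Least rec_on_rec_computable[OF assms(1)] rec_on_prod_encode rec_on_proj) auto
  then show ?thesis unfolding rec_computable_iff by simp
qed

section \<open>Computability on encoded types\<close>

text \<open>A type class lets the type of each subterm fix its coding, so that computability of a
  composite term is proved by \<open>intro\<close> along its structure.\<close>

class encodable =
  fixes enc :: "'a \<Rightarrow> nat"

instantiation nat :: encodable
begin
definition enc_nat_def [simp]: "enc (n :: nat) = n"
instance ..
end

instantiation bool :: encodable
begin
definition enc_bool_def [simp]: "enc (b :: bool) = of_bool b"
instance ..
end

instantiation prod :: (encodable, encodable) encodable
begin
definition enc_prod_def: "enc z = prod_encode (enc (fst z), enc (snd z))"
instance ..
end

instantiation list :: (encodable) encodable
begin
definition enc_list_def: "enc xs = list_encode (map enc xs)"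
instance ..
end

lemma enc_Pair [simp]: "enc (a, b) = prod_encode (enc a, enc b)"
  by (simp add: enc_prod_def)

lemma enc_Nil [simp]: "enc [] = 0"
  by (simp add: enc_list_def)

lemma enc_Cons [simp]: "enc (x # xs) = Suc (prod_encode (enc x, enc xs))"
  by (simp add: enc_list_def)

lemma enc_nat_list: "enc (xs :: nat list) = list_encode xs"
  by (induction xs) auto

definition computable :: "('a::encodable \<Rightarrow> 'b::encodable) \<Rightarrow> bool" where
  "computable f \<longleftrightarrow> (\<exists>h. rec_computable h \<and> (\<forall>x. h (enc x) = enc (f x)))"

named_theorems computable_intros

lemma computable_nat_iff: "computable (h :: nat \<Rightarrow> nat) \<longleftrightarrow> rec_computable h"
  unfolding computable_def
proof safe
  fix g assume "rec_computable g" "\<forall>x. g (enc x) = enc (h x)"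
  moreover from this have "g = h" by auto
  ultimately show "rec_computable h" by simp
qed (auto intro!: exI[of _ h])

lemma computable_id [computable_intros]: "computable (\<lambda>e. e)"
  unfolding computable_def using rec_computable_id by blast

lemma computable_const [computable_intros]: "computable (\<lambda>e. c)"
  unfolding computable_def using rec_computable_const by blast

lemma computable_comp:
  assumes "computable f" "computable g"
  shows "computable (\<lambda>e. f (g e))"
proof -
  obtain h k where "rec_computable h" "\<And>x. h (enc x) = enc (f x)"
      "rec_computable k" "\<And>x. k (enc x) = enc (g x)"
    using assms unfolding computable_def by blast
  then show ?thesis
    unfolding computable_def
    by (intro exI[of _ "\<lambda>x. h (k x)"]) (simp add: rec_computable_comp)
qed

lemma computable_Pair [computable_intros]:
  assumes "computable f" "computable g"
  shows "computable (\<lambda>e. (f e, g e))"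
proof -
  obtain h k where "rec_computable h" "\<And>x. h (enc x) = enc (f x)"
      "rec_computable k" "\<And>x. k (enc x) = enc (g x)"
    using assms unfolding computable_def by blast
  then show ?thesis
    unfolding computable_def
    by (intro exI[of _ "\<lambda>x. prod_encode (h x, k x)"]) (simp add: rec_computable_prod_encode)
qed

lemma computable_comp2:
  assumes "computable (\<lambda>z. F (fst z) (snd z))" "computable f" "computable g"
  shows "computable (\<lambda>e. F (f e) (g e))"
  using computable_comp[OF assms(1) computable_Pair[OF assms(2,3)]] by simp

lemma computable_fst [computable_intros]: "computable f \<Longrightarrow> computable (\<lambda>e. fst (f e))"
  by (rule computable_comp[where f = fst], unfold computable_def)
    (auto intro!: exI[of _ "\<lambda>x. fst (prod_decode x)"] rec_computable_fst)

lemma computable_snd [computable_intros]: "computable f \<Longrightarrow> computable (\<lambda>e. snd (f e))"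
  by (rule computable_comp[where f = snd], unfold computable_def)
    (auto intro!: exI[of _ "\<lambda>x. snd (prod_decode x)"] rec_computable_snd)

text \<open>Only codes matter, so a function may be exchanged for one into another type with the
  same codes, e.g. a truth value for 0 or 1.\<close>

lemma computable_by_enc:
  assumes "computable g" "\<And>e. enc (g e) = enc (f e)"
  shows "computable f"
  using assms unfolding computable_def by auto

lemma computable_add [computable_intros]:
  fixes f g :: "'a::encodable \<Rightarrow> nat"
  assumes "computable f" "computable g"
  shows "computable (\<lambda>e. f e + g e)"
  using assms unfolding computable_def by (auto intro!: rec_computable_add)

lemma computable_diff [computable_intros]:
  fixes f g :: "'a::encodable \<Rightarrow> nat"
  assumes "computable f" "computable g"
  shows "computable (\<lambda>e. f e - g e)"
  using assms unfolding computable_def by (auto intro!: rec_computable_diff)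

lemma computable_Suc [computable_intros]:
  "computable f \<Longrightarrow> computable (\<lambda>e. Suc (f e))"
  using computable_add[OF _ computable_const[of 1], of f] by simp

lemma computable_rec_nat [computable_intros]:
  assumes "computable a" "computable (\<lambda>z. b (fst z) (fst (snd z)) (snd (snd z)))" "computable n"
  shows "computable (\<lambda>e. rec_nat (a e) (b e) (n e))"
proof -
  obtain A B N where A: "rec_computable A" "\<And>x. A (enc x) = enc (a x)"
      and B: "rec_computable B" "\<And>x. B (enc x) = enc (b (fst x) (fst (snd x)) (snd (snd x)))"
      and N: "rec_computable N" "\<And>x. N (enc x) = enc (n x)"
    using assms unfolding computable_def by metis
  have "rec_nat (enc (a x)) (\<lambda>y r. B (prod_encode (enc x, prod_encode (y, r)))) m
      = enc (rec_nat (a x) (b x) m)" for x m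
  proof (induction m)
    case (Suc m)
    then show ?case using B(2)[of "(x, m, rec_nat (a x) (b x) m)"] by simp
  qed simp
  then show ?thesis
    unfolding computable_def
    by (intro exI[of _ "\<lambda>x. rec_nat (A x) (\<lambda>y r. B (prod_encode (x, prod_encode (y, r)))) (N x)"])
      (simp add: A N rec_computable_rec_nat[OF A(1) B(1) N(1)])
qed

lemma computable_If [computable_intros]:
  assumes "computable c" "computable f" "computable g"
  shows "computable (\<lambda>e. if c e then f e else g e)"
proof -
  have "computable (\<lambda>e. of_bool (c e) :: nat)"
    using assms(1) by (rule computable_by_enc) simp
  \<comment> \<open>A recursion of length \<open>of_bool (c e)\<close> makes at most one step, which
    replaces \<open>g e\<close> by \<open>f e\<close>.\<close>
  then have "computable (\<lambda>e. rec_nat (g e) (\<lambda>y r. f e) (of_bool (c e)))"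
    by (intro computable_rec_nat assms(3) computable_comp[OF assms(2)] computable_fst computable_id)
  then show ?thesis
    by (rule computable_by_enc) simp
qed

lemma computable_mult [computable_intros]:
  fixes f g :: "'a::encodable \<Rightarrow> nat"
  assumes "computable f" "computable g"
  shows "computable (\<lambda>e. f e * g e)"
proof -
  have "computable (\<lambda>e. rec_nat 0 (\<lambda>y r. r + g e) (f e))"
    by (intro computable_rec_nat computable_add computable_comp[OF assms(2)] computable_intros assms)
  moreover have "rec_nat 0 (\<lambda>y r. r + b) a = a * b" for a b :: nat
    by (induction a) auto
  ultimately show ?thesis by simp
qed

lemma computable_power [computable_intros]:
  fixes f g :: "'a::encodable \<Rightarrow> nat"
  assumes "computable f" "computable g"
  shows "computable (\<lambda>e. f e ^ g e)"
proof -
  have "computable (\<lambda>e. rec_nat 1 (\<lambda>y r. r * f e) (g e))"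
    by (intro computable_rec_nat computable_mult computable_comp[OF assms(1)] computable_intros assms)
  moreover have "rec_nat 1 (\<lambda>y r. r * b) a = b ^ a" for a b :: nat
    by (induction a) auto
  ultimately show ?thesis by simp
qed

lemma computable_eq_0: 
  fixes f :: "'a::encodable \<Rightarrow> nat"
  assumes "computable f" shows "computable (\<lambda>e. f e = 0)"
  by (rule computable_by_enc[where g = "\<lambda>e. 1 - f e"])
    (auto intro!: computable_intros assms)

lemma computable_le [computable_intros]:
  fixes f g :: "'a::encodable \<Rightarrow> nat"
  assumes "computable f" "computable g"
  shows "computable (\<lambda>e. f e \<le> g e)"
  using computable_eq_0[OF computable_diff[OF assms]] by simp

lemma computable_less [computable_intros]:
  fixes f g :: "'a::encodable \<Rightarrow> nat"
  assumes "computable f" "computable g"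
  shows "computable (\<lambda>e. f e < g e)"
  using computable_le[OF computable_Suc[OF assms(1)] assms(2)] by (simp add: Suc_le_eq)

lemma computable_conj [computable_intros]:
  "computable P \<Longrightarrow> computable Q \<Longrightarrow> computable (\<lambda>e. P e \<and> Q e)"
  by (rule computable_by_enc[where g = "\<lambda>e. if P e then Q e else False"])
    (intro computable_intros | simp)+

lemma computable_not [computable_intros]: "computable P \<Longrightarrow> computable (\<lambda>e. \<not> P e)"
  by (rule computable_by_enc[where g = "\<lambda>e. if P e then False else True"])
    (intro computable_intros | simp)+

lemma computable_disj [computable_intros]:
  "computable P \<Longrightarrow> computable Q \<Longrightarrow> computable (\<lambda>e. P e \<or> Q e)"
  by (rule computable_by_enc[where g = "\<lambda>e. if P e then True else Q e"])
    (intro computable_intros | simp)+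

lemma computable_imp [computable_intros]:
  "computable P \<Longrightarrow> computable Q \<Longrightarrow> computable (\<lambda>e. P e \<longrightarrow> Q e)"
  by (rule computable_by_enc[where g = "\<lambda>e. if P e then Q e else True"])
    (intro computable_intros | simp)+

lemma computable_eq [computable_intros]:
  fixes f g :: "'a::encodable \<Rightarrow> nat"
  assumes "computable f" "computable g"
  shows "computable (\<lambda>e. f e = g e)"
  using computable_conj[OF computable_le[OF assms] computable_le[OF assms(2,1)]]
  by (simp add: eq_iff)

text \<open>Minimisation has to terminate on every number, also on those that encode nothing. Hence the
  restriction to surjective encodings, which excludes \<open>bool\<close>.\<close>

class surj_encodable = encodable +
  assumes surj_enc: "surj (enc :: 'a \<Rightarrow> nat)"

instance nat :: surj_encodable
  by standard (auto simp: surj_def)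

instance prod :: (surj_encodable, surj_encodable) surj_encodable
proof
  have "\<exists>z :: 'a \<times> 'b. n = enc z" for n
  proof -
    obtain a :: 'a and b :: 'b where "fst (prod_decode n) = enc a" "snd (prod_decode n) = enc b"
      using surjD[OF surj_enc[where 'a = 'a]] surjD[OF surj_enc[where 'a = 'b]] by blast
    then have "n = enc (a, b)" by (simp flip: \<open>_ = enc a\<close> \<open>_ = enc b\<close>)
    then show ?thesis ..
  qed
  then show "surj (enc :: 'a \<times> 'b \<Rightarrow> nat)" by (simp add: surj_def)
qed

instance list :: (surj_encodable) surj_encodable
proof
  have "\<exists>z :: 'a list. list_encode xs = enc z" for xs
  proof (induction xs)
    case Nil
    then show ?case by (auto intro: exI[of _ "[]"])
  next
    case (Cons x xs)
    obtain a :: 'a where "x = enc a" by (metis surj_enc surj_def)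
    with Cons show ?case by (metis enc_Cons list_encode.simps(2))
  qed
  then show "surj (enc :: 'a list \<Rightarrow> nat)"
    by (metis list_decode_inverse surj_def)
qed

lemma computable_Least [computable_intros]:
  fixes P :: "'a::surj_encodable \<Rightarrow> nat \<Rightarrow> bool"
  assumes "computable (\<lambda>z. P (fst z) (snd z))" "\<And>e. \<exists>y. P e y"
  shows "computable (\<lambda>e. LEAST y. P e y)"
proof -
  have "computable (\<lambda>z. if P (fst z) (snd z) then 0 else 1 :: nat)"
    by (intro computable_intros assms)
  then obtain h where h: "rec_computable h"
      "\<And>z. h (enc z) = enc (if P (fst z) (snd z) then 0 else 1 :: nat)"
    unfolding computable_def by metis
  have *: "h (prod_encode (enc e, y)) = 0 \<longleftrightarrow> P e y" for e y
    using h(2)[of "(e, y)"] by (simp split: if_splits)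
  have "\<exists>y. h (prod_encode (x, y)) = 0" for x
  proof -
    obtain e :: 'a where "x = enc e" using surjD[OF surj_enc[where 'a = 'a]] by blast
    then show ?thesis using * assms(2) by auto
  qed
  from rec_computable_Least[OF h(1) this] show ?thesis
    unfolding computable_def by (auto simp: *)
qed

lemma computable_all_less [computable_intros]:
  fixes P :: "'a::encodable \<Rightarrow> nat \<Rightarrow> bool"
  assumes "computable (\<lambda>z. P (fst z) (snd z))" "computable n"
  shows "computable (\<lambda>e. \<forall>i<n e. P e i)"
proof -
  have "computable (\<lambda>e. rec_nat True (\<lambda>i r. r \<and> P e i) (n e))"
    by (intro computable_rec_nat computable_conj computable_comp2[OF assms(1)] computable_intros assms)
  moreover have "rec_nat True (\<lambda>i r. r \<and> Q i) m = (\<forall>i<m. Q i)" for Q m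
    by (induction m) (auto simp: less_Suc_eq)
  ultimately show ?thesis by simp
qed

lemma computable_ex_less [computable_intros]:
  fixes P :: "'a::encodable \<Rightarrow> nat \<Rightarrow> bool"
  assumes "computable (\<lambda>z. P (fst z) (snd z))" "computable n"
  shows "computable (\<lambda>e. \<exists>i<n e. P e i)"
  using computable_not[OF computable_all_less[OF computable_not[OF assms(1)] assms(2)]] by simp

section \<open>Decoding, lists and parity\<close>

lemma computable_prod_encode [computable_intros]:
  "computable f \<Longrightarrow> computable g \<Longrightarrow> computable (\<lambda>e. prod_encode (f e, g e))"
  by (rule computable_by_enc[where g = "\<lambda>e. (f e, g e)"]) (intro computable_intros | simp)+

text \<open>The coding of pairs satisfies \<open>enc (prod_decode n) = n\<close>, so decoding does
  nothing to the codes; the same happens with lists of naturals below.\<close>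

lemma computable_prod_decode [computable_intros]:
  "computable f \<Longrightarrow> computable (\<lambda>e. prod_decode (f e))"
  by (rule computable_by_enc[where g = f]) (auto simp: enc_prod_def)

lemma computable_list_decode [computable_intros]:
  "computable f \<Longrightarrow> computable (\<lambda>e. list_decode (f e))"
  by (rule computable_by_enc[where g = f]) (auto simp: enc_nat_list)

lemma computable_list_encode [computable_intros]:
  "computable f \<Longrightarrow> computable (\<lambda>e. list_encode (f e))"
  by (rule computable_by_enc[where g = f]) (auto simp: enc_nat_list)

lemma computable_Cons [computable_intros]:
  assumes "computable f" "computable g" shows "computable (\<lambda>e. f e # g e)"
proof -
  obtain h where h: "rec_computable h" "\<And>x. h (enc x) = enc (f x, g x)"
    using computable_Pair[OF assms] unfolding computable_def by metis
  have "rec_computable (\<lambda>x. h x + 1)"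
    by (intro rec_computable_add rec_computable_const h)
  with h(2) show ?thesis
    unfolding computable_def by (intro exI[of _ "\<lambda>x. h x + 1"]) simp
qed

lemma prod_decode_0: "prod_decode 0 = (0, 0)"
  by (simp add: prod_decode_def prod_decode_aux.simps)

lemma computable_tl [computable_intros]:
  assumes "computable f" shows "computable (\<lambda>e. tl (f e))"
proof (rule computable_comp[OF _ assms])
  have "rec_computable (\<lambda>x. snd (prod_decode (x - 1)))"
    by (intro rec_computable_comp[OF rec_computable_snd] rec_computable_diff rec_computable_id
        rec_computable_const)
  \<comment> \<open>For \<open>[]\<close> the truncated \<open>0 - 1 = 0\<close> and
    \<open>prod_decode 0 = (0, 0)\<close> give 0, the code of \<open>tl [] = []\<close>.\<close>
  moreover have "snd (prod_decode (enc xs - 1)) = enc (tl xs)" for xs :: "'b list"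
    by (cases xs) (simp_all add: prod_decode_0)
  ultimately show "computable (tl :: 'b list \<Rightarrow> 'b list)"
    unfolding computable_def by blast
qed

text \<open>The value of \<open>xs ! i\<close> beyond the end of \<open>xs\<close> is unspecified,
  and machines meet prefixes that are too short. The default 0 also makes \<open>nth0 w\<close> a
  name that extends the prefix \<open>w\<close>, so that constructions on names can be run on
  prefixes.\<close>

definition nth0 :: "nat list \<Rightarrow> nat \<Rightarrow> nat" where
  "nth0 xs i = (if i < length xs then xs ! i else 0)"

lemma computable_nth0 [computable_intros]:
  assumes "computable f" "computable n" shows "computable (\<lambda>e. nth0 (f e) (n e))"
proof -
  have "computable (\<lambda>e. rec_nat (f e) (\<lambda>i r. tl r) (n e))"
    by (intro computable_intros assms)
  moreover have "rec_nat xs (\<lambda>i r. tl r) m = drop m xs" for xs :: "nat list" and m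
    by (induction m) (auto simp: drop_Suc tl_drop)
  ultimately have "computable (\<lambda>e. fst (prod_decode (list_encode (drop (n e) (f e)) - 1)))"
    by (intro computable_intros) simp
  moreover have "fst (prod_decode (list_encode (drop m xs) - 1)) = nth0 xs m" for m xs
    by (cases "m < length xs")
      (simp_all add: nth0_def Cons_nth_drop_Suc[symmetric] prod_decode_0
        del: Cons_nth_drop_Suc)
  ultimately show ?thesis by simp
qed

lemma computable_length [computable_intros]:
  fixes f :: "'a::surj_encodable \<Rightarrow> nat list"
  assumes "computable f" shows "computable (\<lambda>e. length (f e))"
proof (rule computable_comp[OF _ assms])
  \<comment> \<open>Counts how many tails have to be taken until the code is 0, which is the code of
    \<open>[]\<close> alone.\<close>
  have "computable (\<lambda>xs :: nat list. LEAST n. list_encode (rec_nat xs (\<lambda>i r. tl r) n) = 0)"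
  proof (intro computable_intros)
    fix xs :: "nat list"
    have "rec_nat xs (\<lambda>i r. tl r) m = drop m xs" for m
      by (induction m) (auto simp: drop_Suc tl_drop)
    then show "\<exists>n. list_encode (rec_nat xs (\<lambda>i r. tl r) n) = 0"
      by (intro exI[of _ "length xs"]) simp
  qed
  moreover have "(LEAST n. list_encode (rec_nat xs (\<lambda>i r. tl r) n) = 0) = length xs" for xs :: "nat list"
  proof -
    have *: "rec_nat xs (\<lambda>i r. tl r) m = drop m xs" for m
      by (induction m) (auto simp: drop_Suc tl_drop)
    have "list_encode ys = 0 \<longleftrightarrow> ys = []" for ys
      by (cases ys) auto
    then show ?thesis unfolding * by (auto intro!: Least_equality)
  qed
  ultimately show "computable (length :: nat list \<Rightarrow> nat)" by simp
qed

lemma computable_map_upt [computable_intros]: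
  assumes "computable (\<lambda>z. F (fst z) (snd z))" "computable n"
  shows "computable (\<lambda>e. map (F e) [0..<n e])"
proof -
  \<comment> \<open>The list grows at its head, so the recursion visits the arguments downwards from
    \<open>n e - 1\<close>.\<close>
  have "computable (\<lambda>e. rec_nat [] (\<lambda>i r. F e (n e - Suc i) # r) (n e))"
    by (intro computable_rec_nat computable_Cons computable_comp2[OF assms(1)]
        computable_comp[OF assms(2)] computable_intros assms)
  moreover have "rec_nat [] (\<lambda>i r. G (m - Suc i) # r) j = map G [m - j..<m]"
    if "j \<le> m" for G :: "nat \<Rightarrow> 'b" and m j
    using that
  proof (induction j)
    case (Suc j)
    then have "[m - Suc j..<m] = (m - Suc j) # [m - j..<m]"
      by (simp add: upt_conv_Cons Suc_diff_Suc)
    with Suc show ?case by simp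
  qed simp
  ultimately show ?thesis by simp
qed

lemma computable_div_2 [computable_intros]:
  fixes f :: "'a::surj_encodable \<Rightarrow> nat"
  assumes "computable f" shows "computable (\<lambda>e. f e div 2)"
proof -
  have "computable (\<lambda>e. LEAST y. f e < 2 * Suc y)"
  proof (intro computable_intros computable_comp[OF assms])
    show "\<exists>y. f e < 2 * Suc y" for e by (rule exI[of _ "f e"]) simp
  qed
  moreover have "(LEAST y. m < 2 * Suc y) = m div 2" for m :: nat
    by (rule Least_equality) auto
  ultimately show ?thesis by simp
qed

lemma computable_even [computable_intros]:
  fixes f :: "'a::surj_encodable \<Rightarrow> nat"
  assumes "computable f" shows "computable (\<lambda>e. even (f e))"
proof -
  have "computable (\<lambda>e. 2 * (f e div 2) = f e)"
    by (intro computable_intros assms)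
  moreover have "2 * (m div 2) = m \<longleftrightarrow> even m" for m :: nat by presburger
  ultimately show ?thesis by simp
qed

lemma computable_rec_computable:
  "rec_computable h \<Longrightarrow> computable f \<Longrightarrow> computable (\<lambda>e. h (f e))"
  using computable_comp[of h f] by (simp add: computable_nat_iff)

section \<open>Rational arithmetic and rational vectors\<close>

text \<open>Rationals are carried as fractions with a difference of naturals as numerator, so that all
  rational arithmetic reduces to arithmetic on naturals.\<close>

definition rat_computable :: "('a::encodable \<Rightarrow> real) \<Rightarrow> bool" where
  "rat_computable F \<longleftrightarrow> (\<exists>A B C. computable A \<and> computable B \<and> computable C \<and>
     (\<forall>e. F e = (real (A e) - real (B e)) / (1 + real (C e))))"

lemma rat_computableI:
  assumes "computable A" "computable B" "computable C"
    "\<And>e. F e = (real (A e) - real (B e)) / (1 + real (C e))"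
  shows "rat_computable F"
  using assms unfolding rat_computable_def by blast

lemma rat_computable_of_nat [computable_intros]:
  "computable n \<Longrightarrow> rat_computable (\<lambda>e. real (n e))"
  by (rule rat_computableI[where A = n and B = "\<lambda>_. 0" and C = "\<lambda>_. 0"])
    (auto intro: computable_intros)

lemma rat_computable_0 [computable_intros]: "rat_computable (\<lambda>e. 0)"
  using rat_computable_of_nat[OF computable_const[of 0]] by simp

lemma rat_computable_numeral [computable_intros]: "rat_computable (\<lambda>e. numeral k)"
  using rat_computable_of_nat[OF computable_const[of "numeral k"]] by simp

lemma rat_computable_add [computable_intros]:
  assumes "rat_computable F" "rat_computable G"
  shows "rat_computable (\<lambda>e. F e + G e)"
proof -
  obtain A B C A' B' C' where *: "computable A" "computable B" "computable C"
    "computable A'" "computable B'" "computable C'"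
    "\<And>e. F e = (real (A e) - real (B e)) / (1 + real (C e))"
    "\<And>e. G e = (real (A' e) - real (B' e)) / (1 + real (C' e))"
    using assms unfolding rat_computable_def by metis
  show ?thesis
  proof (rule rat_computableI)
    show "computable (\<lambda>e. A e * Suc (C' e) + A' e * Suc (C e))"
      "computable (\<lambda>e. B e * Suc (C' e) + B' e * Suc (C e))"
      "computable (\<lambda>e. C e + C' e + C e * C' e)"
      by (intro computable_intros *)+
    fix e
    have "1 + real (C e) \<noteq> 0" "1 + real (C' e) \<noteq> 0"
      using of_nat_0_le_iff[of "C e"] of_nat_0_le_iff[of "C' e"] by linarith+
    moreover have "1 + real (C e + C' e + C e * C' e) = (1 + real (C e)) * (1 + real (C' e))"
      by (simp add: algebra_simps)
    ultimately show "F e + G e = (real (A e * Suc (C' e) + A' e * Suc (C e))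
        - real (B e * Suc (C' e) + B' e * Suc (C e))) / (1 + real (C e + C' e + C e * C' e))"
      unfolding * by (simp add: add_frac_eq) (simp add: algebra_simps)
  qed
qed

lemma rat_computable_mult [computable_intros]:
  assumes "rat_computable F" "rat_computable G"
  shows "rat_computable (\<lambda>e. F e * G e)"
proof -
  obtain A B C A' B' C' where *: "computable A" "computable B" "computable C"
    "computable A'" "computable B'" "computable C'"
    "\<And>e. F e = (real (A e) - real (B e)) / (1 + real (C e))"
    "\<And>e. G e = (real (A' e) - real (B' e)) / (1 + real (C' e))"
    using assms unfolding rat_computable_def by metis
  show ?thesis
  proof (rule rat_computableI)
    show "computable (\<lambda>e. A e * A' e + B e * B' e)"
      "computable (\<lambda>e. A e * B' e + B e * A' e)"
      "computable (\<lambda>e. C e + C' e + C e * C' e)"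
      by (intro computable_intros *)+
    fix e
    have "1 + real (C e + C' e + C e * C' e) = (1 + real (C e)) * (1 + real (C' e))"
      by (simp add: algebra_simps)
    then show "F e * G e = (real (A e * A' e + B e * B' e)
        - real (A e * B' e + B e * A' e)) / (1 + real (C e + C' e + C e * C' e))"
      unfolding * by simp (simp add: algebra_simps)
  qed
qed

lemma rat_computable_minus [computable_intros]:
  assumes "rat_computable F" shows "rat_computable (\<lambda>e. - F e)"
proof -
  obtain A B C where *: "computable A" "computable B" "computable C"
    "\<And>e. F e = (real (A e) - real (B e)) / (1 + real (C e))"
    using assms unfolding rat_computable_def by metis
  show ?thesis
    by (rule rat_computableI[OF *(2,1,3)]) (simp only: * minus_divide_left minus_diff_eq)
qed

lemma rat_computable_diff [computable_intros]:
  assumes "rat_computable F" "rat_computable G"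
  shows "rat_computable (\<lambda>e. F e - G e)"
  using rat_computable_add[OF assms(1) rat_computable_minus[OF assms(2)]] by simp

lemma rat_computable_power2 [computable_intros]:
  "rat_computable F \<Longrightarrow> rat_computable (\<lambda>e. (F e)\<^sup>2)"
  unfolding power2_eq_square by (intro computable_intros)

lemma rat_computable_inverse_power2 [computable_intros]:
  assumes "computable n" shows "rat_computable (\<lambda>e. inverse (2 ^ n e))"
proof (rule rat_computableI)
  show "computable (\<lambda>e. 1 :: nat)" "computable (\<lambda>e. 0 :: nat)" "computable (\<lambda>e. 2 ^ n e - 1 :: nat)"
    by (intro computable_intros assms)+
  show "inverse (2 ^ n e) = (real 1 - real 0) / (1 + real (2 ^ n e - 1))" for e
    by (simp add: of_nat_diff divide_inverse)
qed

lemma rat_computable_If [computable_intros]: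
  assumes "computable P" "rat_computable F" "rat_computable G"
  shows "rat_computable (\<lambda>e. if P e then F e else G e)"
proof -
  obtain A B C A' B' C' where *: "computable A" "computable B" "computable C"
    "computable A'" "computable B'" "computable C'"
    "\<And>e. F e = (real (A e) - real (B e)) / (1 + real (C e))"
    "\<And>e. G e = (real (A' e) - real (B' e)) / (1 + real (C' e))"
    using assms(2,3) unfolding rat_computable_def by metis
  show ?thesis
    by (rule rat_computableI[where A = "\<lambda>e. if P e then A e else A' e" and
          B = "\<lambda>e. if P e then B e else B' e" and C = "\<lambda>e. if P e then C e else C' e"])
      (intro computable_intros * assms | simp add: *)+
qed

lemma rat_computable_sum [computable_intros]:
  assumes "\<And>i. i \<in> S \<Longrightarrow> rat_computable (F i)"
  shows "rat_computable (\<lambda>e. \<Sum>i\<in>S. F i e)"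
  using assms
  by (induction S rule: infinite_finite_induct) (auto intro!: rat_computable_0 rat_computable_add)

lemma computable_rat_less [computable_intros]:
  assumes "rat_computable F" "rat_computable G"
  shows "computable (\<lambda>e. F e < G e)"
proof -
  obtain A B C where *: "computable A" "computable B" "computable C"
    "\<And>e. G e - F e = (real (A e) - real (B e)) / (1 + real (C e))"
    using rat_computable_diff[OF assms(2,1)] unfolding rat_computable_def by metis
  have "F e < G e \<longleftrightarrow> B e < A e" for e
  proof -
    have "F e < G e \<longleftrightarrow> 0 < G e - F e" by auto
    also have "\<dots> \<longleftrightarrow> B e < A e"
      unfolding * by (auto simp: zero_less_divide_iff)
    finally show ?thesis .
  qed
  then show ?thesis using computable_less[OF *(2,1)] by simp
qed

lemma rat_computable_rat_dec [computable_intros]: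
  fixes c :: "'a::surj_encodable \<Rightarrow> nat"
  assumes "computable c" shows "rat_computable (\<lambda>e. rat_dec (c e))"
proof (rule rat_computableI)
  let ?a = "\<lambda>e. fst (prod_decode (c e))"
  show "computable (\<lambda>e. if even (?a e) then ?a e div 2 else 0)"
    "computable (\<lambda>e. if even (?a e) then 0 else Suc (?a e div 2))"
    "computable (\<lambda>e. snd (prod_decode (c e)))"
    by (intro computable_intros assms)+
  show "rat_dec (c e) = (real (if even (?a e) then ?a e div 2 else 0)
      - real (if even (?a e) then 0 else Suc (?a e div 2))) / (1 + real (snd (prod_decode (c e))))" for e
    by (cases "even (?a e)")
      (simp_all add: rat_dec_def case_prod_beta int_decode_def sum_decode_def)
qed

text \<open>The distance of two rational vectors may be irrational; comparing squares stays within
  the rationals. The test \<open>0 < r e\<close> excludes negative radii, whose squares could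
  pass.\<close>

lemma computable_dist_vec_dec_less [computable_intros]:
  fixes c d :: "'a::surj_encodable \<Rightarrow> nat"
  assumes "computable c" "computable d" "rat_computable r"
  shows "computable (\<lambda>e. dist (vec_dec (c e) :: real ^ 'n::finite) (vec_dec (d e)) < r e)"
proof -
  have coord: "rat_computable (\<lambda>e. (vec_dec (b e) :: real ^ 'n) $ i)" if "computable b"
    for b :: "'a \<Rightarrow> nat" and i
  proof -
    have "rat_computable (\<lambda>e. if to_nat i < length (list_decode (b e))
        then rat_dec (nth0 (list_decode (b e)) (to_nat i)) else 0)"
      by (intro computable_intros that)
    then show ?thesis
      by (simp add: vec_dec_def nth0_def cong: if_cong)
  qed
  have "computable (\<lambda>e. 0 < r e \<and>
      (\<Sum>i\<in>UNIV. ((vec_dec (c e) :: real ^ 'n) $ i - vec_dec (d e) $ i)\<^sup>2) < (r e)\<^sup>2)"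
    by (intro computable_intros coord assms)
  moreover have "0 < s \<and> (\<Sum>i\<in>UNIV. (x $ i - y $ i)\<^sup>2) < s\<^sup>2 \<longleftrightarrow> dist x y < s"
    for x y :: "real ^ 'n" and s
  proof -
    have "(dist x y)\<^sup>2 = (\<Sum>i\<in>UNIV. (x $ i - y $ i)\<^sup>2)"
      by (simp add: dist_vec_def L2_set_def dist_real_def sum_nonneg)
    moreover have "0 < s \<and> (dist x y)\<^sup>2 < s\<^sup>2 \<longleftrightarrow> dist x y < s"
      using power2_less_imp_less[of "dist x y" s] power_strict_mono[of "dist x y" s 2]
        le_less_trans[OF zero_le_dist, of x y s] by auto
    ultimately show ?thesis by simp
  qed
  ultimately show ?thesis by simp
qed

section \<open>Codes of powers of two and finite rational grids\<close>

lemma rat_dec_0 [simp]: "rat_dec 0 = 0"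
  by (simp add: rat_dec_def prod_decode_0 int_decode_def sum_decode_def)

lemma vec_dec_0 [simp]: "vec_dec 0 = 0"
  by (simp add: vec_dec_def vec_eq_iff)

text \<open>2 is \<open>int_encode 1\<close>, and \<open>rat_dec\<close> uses the successor of the
  second component as denominator.\<close>

definition inv_pow_code :: "nat \<Rightarrow> nat" where
  "inv_pow_code k = prod_encode (2, 2 ^ k - 1)"

lemma rat_dec_inv_pow_code [simp]: "rat_dec (inv_pow_code k) = inverse (2 ^ k)"
  by (simp add: inv_pow_code_def rat_dec_def int_decode_def sum_decode_def of_nat_diff
      divide_inverse)

lemma computable_inv_pow_code [computable_intros]:
  "computable f \<Longrightarrow> computable (\<lambda>e. inv_pow_code (f e))"
  unfolding inv_pow_code_def by (intro computable_intros)

lemma prod_encode_mono: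
  assumes "a \<le> a'" "b \<le> b'" shows "prod_encode (a, b) \<le> prod_encode (a', b')"
proof -
  have "triangle m \<le> triangle n" if "m \<le> n" for m n
    using that by (induction rule: dec_induct) auto
  then show ?thesis using assms by (simp add: prod_encode_def add_mono)
qed

lemma list_encode_map_mono:
  "(\<And>x. x \<in> set xs \<Longrightarrow> f x \<le> g x) \<Longrightarrow> list_encode (map f xs) \<le> list_encode (map g xs)"
  by (induction xs) (auto intro: prod_encode_mono)

text \<open>Each entry bounds the codes of the fractions with denominator \<open>2^a\<close> and
  absolute value at most \<open>K\<close>. Since the codings of pairs and lists are monotone, the
  whole list bounds the codes of all grid vectors. The bound is explicit because a machine has to
  compute it from \<open>a\<close> and \<open>K\<close>.\<close>

definition grid_bound :: "nat \<Rightarrow> nat \<Rightarrow> nat \<Rightarrow> nat" where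
  "grid_bound L a K = list_encode (map (\<lambda>_. prod_encode (2 * (K * 2 ^ a) + 2, 2 ^ a - 1)) [0..<L])"

lemma computable_grid_bound [computable_intros]:
  assumes "computable a" "computable K"
  shows "computable (\<lambda>e. grid_bound L (a e) (K e))"
  unfolding grid_bound_def
  by (intro computable_intros computable_comp[OF assms(1)] computable_comp[OF assms(2)])

lemma ex_rat_dec_grid:
  assumes "\<bar>x\<bar> \<le> real K"
  shows "\<exists>c \<le> prod_encode (2 * (K * 2 ^ a) + 2, 2 ^ a - 1). \<bar>rat_dec c - x\<bar> \<le> inverse (2 ^ a)"
proof -
  define z where "z = \<lfloor>x * 2 ^ a\<rfloor>"
  have "x * 2 ^ a \<le> real K * 2 ^ a" "- (real K * 2 ^ a) \<le> x * 2 ^ a"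
    using assms mult_right_mono[of x "real K" "2 ^ a"] mult_right_mono[of "- real K" x "2 ^ a"]
    by (simp_all add: abs_le_iff)
  moreover from this(1) have "x * 2 ^ a < real K * 2 ^ a + 1" by linarith
  ultimately have 1: "z \<le> int (K * 2 ^ a)" "- int (K * 2 ^ a) \<le> z"
    unfolding z_def by (simp_all add: floor_le_iff le_floor_iff)
  have "int_encode z \<le> 2 * (K * 2 ^ a) + 2"
  proof (cases "0 \<le> z")
    case True
    then have "nat z \<le> K * 2 ^ a" using 1(1) by (simp add: nat_le_iff)
    then show ?thesis using True by (simp add: int_encode_def sum_encode_def)
  next
    case False
    then have "nat (- z - 1) \<le> K * 2 ^ a" using 1(2) by (simp add: nat_le_iff)
    then show ?thesis using False by (simp add: int_encode_def sum_encode_def)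
  qed
  then have "prod_encode (int_encode z, 2 ^ a - 1) \<le> prod_encode (2 * (K * 2 ^ a) + 2, 2 ^ a - 1)"
    by (rule prod_encode_mono) simp
  moreover have "\<bar>rat_dec (prod_encode (int_encode z, 2 ^ a - 1)) - x\<bar> \<le> inverse (2 ^ a)"
  proof -
    have "\<bar>of_int z - x * 2 ^ a\<bar> \<le> 1" unfolding z_def by linarith
    then have "\<bar>of_int z - x * 2 ^ a\<bar> / 2 ^ a \<le> 1 / 2 ^ a" by (simp add: divide_right_mono)
    moreover have "of_int z / 2 ^ a - x = (of_int z - x * 2 ^ a) / 2 ^ a"
      by (simp add: diff_divide_distrib)
    ultimately show ?thesis
      by (simp add: rat_dec_def of_nat_diff abs_divide inverse_eq_divide)
  qed
  ultimately show ?thesis by blast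
qed

text \<open>The bound is independent of the point, which makes a finite search of a rational grid exhaustive.
  The precision is shifted by the dimension to pass from coordinates to Euclidean distance.\<close>

lemma ex_vec_dec_grid:
  obtains L where "\<And>(x :: real ^ 'n::finite) K a. norm x \<le> real K \<Longrightarrow>
     \<exists>c \<le> grid_bound L (a + CARD('n)) K. dist (vec_dec c) x < inverse (2 ^ a)"
proof -
  \<comment> \<open>\<open>to_nat\<close> is merely some injection of the finite index type; its
    largest value fixes the length of the coding lists, and positions outside its range are filled
    with 0.\<close>
  define L where "L = Suc (Max (range (to_nat :: 'n \<Rightarrow> nat)))"
  have to_nat_L: "to_nat (i :: 'n) < L" for i
    unfolding L_def by (simp add: le_imp_less_Suc)
  have "\<exists>c \<le> grid_bound L (a + CARD('n)) K. dist (vec_dec c) x < inverse (2 ^ a)"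
    if K: "norm x \<le> real K" for x :: "real ^ 'n" and K a
  proof -
    let ?b = "a + CARD('n)"
    have "\<bar>x $ i\<bar> \<le> real K" for i using K component_le_norm_cart[of x i] by linarith
    then have "\<forall>i. \<exists>c \<le> prod_encode (2 * (K * 2 ^ ?b) + 2, 2 ^ ?b - 1).
        \<bar>rat_dec c - x $ i\<bar> \<le> inverse (2 ^ ?b)"
      using ex_rat_dec_grid by blast
    then obtain d where d: "\<And>i. d i \<le> prod_encode (2 * (K * 2 ^ ?b) + 2, 2 ^ ?b - 1)"
        "\<And>i. \<bar>rat_dec (d i) - x $ i\<bar> \<le> inverse (2 ^ ?b)" by metis
    define c where "c = list_encode (map (\<lambda>j. if j \<in> range (to_nat :: 'n \<Rightarrow> nat)
      then d (from_nat j) else 0) [0..<L])"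
    have "c \<le> grid_bound L ?b K"
      unfolding c_def grid_bound_def by (rule list_encode_map_mono) (use d(1) in \<open>auto simp del: prod_encode_eq\<close>)
    have c: "vec_dec c $ i = rat_dec (d i)" for i
      using to_nat_L[of i] by (simp add: vec_dec_def c_def)
    have "dist (vec_dec c) x \<le> (\<Sum>i\<in>UNIV. \<bar>(vec_dec c - x) $ i\<bar>)"
      unfolding dist_norm by (rule norm_le_l1_cart)
    also have "\<dots> \<le> (\<Sum>i\<in>(UNIV :: 'n set). inverse (2 ^ ?b))"
      by (rule sum_mono) (simp add: c d)
    also have "\<dots> = inverse (2 ^ a) * (real CARD('n) / 2 ^ CARD('n))"
      by (simp add: power_add field_simps)
    also have "\<dots> < inverse (2 ^ a)"
    proof -
      have "real CARD('n) < 2 ^ CARD('n)" by (rule of_nat_less_two_power)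
      then have "real CARD('n) / 2 ^ CARD('n) < 1" by simp
      then show ?thesis by (simp add: field_simps)
    qed
    finally show ?thesis using \<open>c \<le> _\<close> by blast
  qed
  then show thesis using that by blast
qed

lemma ex_vec_dec_near:
  fixes x :: "real ^ 'n::finite"
  assumes "0 < e" shows "\<exists>c. dist (vec_dec c) x < e"
proof -
  obtain L where L: "\<And>(x :: real ^ 'n) K a. norm x \<le> real K \<Longrightarrow>
     \<exists>c \<le> grid_bound L (a + CARD('n)) K. dist (vec_dec c) x < inverse (2 ^ a)"
    using ex_vec_dec_grid[where 'n = 'n] by blast
  obtain a where "(1 / 2 :: real) ^ a < e" using real_arch_pow_inv[OF assms, of "1/2"] by auto
  then have "inverse (2 ^ a) < e" by (simp add: power_one_over inverse_eq_divide)
  moreover obtain K where "norm x \<le> real K" using real_arch_simple by blast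
  ultimately show ?thesis using L[of x K a] by (meson less_trans)
qed

section \<open>Type-2 machines\<close>

definition pre :: "name \<Rightarrow> nat \<Rightarrow> nat list" where
  "pre p n = map p [0..<n]"

lemma length_pre [simp]: "length (pre p n) = n"
  by (simp add: pre_def)

lemma nth0_pre [simp]: "i < n \<Longrightarrow> nth0 (pre p n) i = p i"
  by (simp add: pre_def nth0_def)

lemma pre_cong: "(\<And>i. i < n \<Longrightarrow> p i = q i) \<Longrightarrow> pre p n = pre q n"
  by (simp add: pre_def)

lemma pcode_eq_list_encode_pre: "pcode p n = list_encode (pre p n)"
  by (simp add: pcode_def pre_def)

lemma computable_pre [computable_intros]:
  "computable (\<lambda>z. P (fst z) (snd z)) \<Longrightarrow> computable n \<Longrightarrow> computable (\<lambda>e. pre (P e) (n e))"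
  unfolding pre_def by (rule computable_map_upt)

text \<open>A machine may answer as soon as some certificate \<open>t\<close> is found: the first one in a fixed
  enumeration of certificates and prefix lengths is used, so certificates need not agree.\<close>

lemma mv_computableI:
  fixes G :: "nat \<Rightarrow> nat list \<Rightarrow> nat list \<Rightarrow> nat"
  assumes G: "computable (\<lambda>z. G (fst z) (fst (snd z)) (snd (snd z)))"
    and ex: "\<And>a p i. a \<in> D \<Longrightarrow> \<delta> p a \<Longrightarrow> \<exists>t n. G i t (pre p n) \<noteq> 0"
    and ok: "\<And>a p q. a \<in> D \<Longrightarrow> \<delta> p a \<Longrightarrow> (\<And>i. \<exists>t n. G i t (pre p n) = Suc (q i)) \<Longrightarrow>
      \<exists>b\<in>H a. \<delta>' q b"
  shows "mv_computable \<delta> \<delta>' D H"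
proof -
  define g where "g i w m = G i (list_decode (fst (prod_decode m)))
    (pre (nth0 w) (snd (prod_decode m)))" for i w m
  \<comment> \<open>The disjunct \<open>length w \<le> m\<close> makes the search total. A code
    \<open>m \<le> length w\<close> refers to a prefix of length at most \<open>m\<close>, which
    \<open>w\<close> determines; hence all long enough prefixes find the same least
    \<open>m\<close>, and their answers agree as \<open>t2_out\<close> demands.\<close>
  define h where "h i w = g i w (LEAST m. g i w m \<noteq> 0 \<or> length w \<le> m)" for i w
  have G3: "computable (\<lambda>e. G (a e) (b e) (c e))"
    if "computable a" "computable b" "computable c"
    for a :: "'e::encodable \<Rightarrow> nat" and b c
    using computable_comp[OF G computable_Pair[OF that(1) computable_Pair[OF that(2,3)]]] by simp
  have "computable (\<lambda>x. h (fst (prod_decode x)) (list_decode (snd (prod_decode x))))"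
    unfolding h_def g_def by (intro computable_intros G3) auto
  then have h: "rec_computable (\<lambda>x. h (fst (prod_decode x)) (list_decode (snd (prod_decode x))))"
    by (simp add: computable_nat_iff)
  have "\<exists>q. \<exists>b\<in>H a. t2_out (\<lambda>x. h (fst (prod_decode x)) (list_decode (snd (prod_decode x)))) p q \<and> \<delta>' q b"
    if a: "a \<in> D" "\<delta> p a" for a p
  proof -
    define c where "c i m = G i (list_decode (fst (prod_decode m))) (pre p (snd (prod_decode m)))" for i m
    have c_ex: "\<exists>m. c i m \<noteq> 0" for i
    proof -
      obtain t n where "G i t (pre p n) \<noteq> 0" using ex[OF a] by blast
      then show ?thesis by (intro exI[of _ "prod_encode (list_encode t, n)"]) (simp add: c_def)
    qed
    define m0 where "m0 i = (LEAST m. c i m \<noteq> 0)" for i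
    have m0: "c i (m0 i) \<noteq> 0" and m0_least: "m < m0 i \<Longrightarrow> c i m = 0" for i m
      using LeastI_ex[OF c_ex, of i] not_less_Least[of m "\<lambda>m. c i m \<noteq> 0"] by (auto simp: m0_def)
    have g: "g i (pre p N) m = c i m" if "m \<le> N" for i N m
    proof -
      have "snd (prod_decode m) \<le> m"
        by (metis le_prod_encode_2 prod.collapse prod_decode_inverse)
      with that have "pre (nth0 (pre p N)) (snd (prod_decode m)) = pre p (snd (prod_decode m))"
        by (intro pre_cong) simp
      then show ?thesis by (simp add: g_def c_def)
    qed
    have hN: "h i (pre p N) = (if m0 i \<le> N then c i (m0 i) else 0)" for i N
    proof (cases "m0 i \<le> N")
      case True
      have "(LEAST m. g i (pre p N) m \<noteq> 0 \<or> length (pre p N) \<le> m) = m0 i"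
      proof (rule Least_equality)
        show "g i (pre p N) (m0 i) \<noteq> 0 \<or> length (pre p N) \<le> m0 i" using m0 g True by simp
        fix m assume "g i (pre p N) m \<noteq> 0 \<or> length (pre p N) \<le> m"
        then show "m0 i \<le> m"
          using True g[of m N i] m0_least[of m i] by (cases "m \<le> N"; force simp: not_le)
      qed
      then show ?thesis using True g by (simp add: h_def)
    next
      case False
      have "(LEAST m. g i (pre p N) m \<noteq> 0 \<or> length (pre p N) \<le> m) = N"
      proof (rule Least_equality)
        fix m assume "g i (pre p N) m \<noteq> 0 \<or> length (pre p N) \<le> m"
        then show "N \<le> m"
          using False g[of m N i] m0_least[of m i] by (cases "m \<le> N") auto
      qed simp
      then show ?thesis using False g[of N N i] m0_least[of N i] by (simp add: h_def)
    qed
    define q where "q i = c i (m0 i) - 1" for i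
    have q: "c i (m0 i) = Suc (q i)" for i using m0[of i] by (simp add: q_def)
    have "t2_out (\<lambda>x. h (fst (prod_decode x)) (list_decode (snd (prod_decode x)))) p q"
      unfolding t2_out_def by (auto simp: pcode_eq_list_encode_pre hN q split: if_splits)
    moreover have "\<exists>t n. G i t (pre p n) = Suc (q i)" for i
      using q[of i] unfolding c_def by blast
    ultimately show ?thesis using ok[OF a] by blast
  qed
  then show ?thesis unfolding mv_computable_def using h by blast
qed

lemma mv_computableE:
  assumes "mv_computable \<delta> \<delta>' D H"
  obtains M where "computable (\<lambda>z. M (fst z) (snd z))"
    "\<And>a p. a \<in> D \<Longrightarrow> \<delta> p a \<Longrightarrow> \<exists>q. \<exists>b\<in>H a. \<delta>' q b \<and>
      (\<forall>i. (\<exists>n. M i (pre p n) = Suc (q i)) \<and> (\<forall>n v. M i (pre p n) = Suc v \<longrightarrow> v = q i))"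
proof -
  obtain h where h: "rec_computable h"
    "\<And>a p. a \<in> D \<Longrightarrow> \<delta> p a \<Longrightarrow> \<exists>q b. t2_out h p q \<and> \<delta>' q b \<and> b \<in> H a"
    using assms unfolding mv_computable_def by blast
  show thesis
  proof
    show "computable (\<lambda>z. h (prod_encode (fst z, list_encode (snd z))))"
      by (intro computable_rec_computable[OF h(1)] computable_intros)
    show "\<exists>q. \<exists>b\<in>H a. \<delta>' q b \<and>
      (\<forall>i. (\<exists>n. h (prod_encode (i, list_encode (pre p n))) = Suc (q i)) \<and>
        (\<forall>n v. h (prod_encode (i, list_encode (pre p n))) = Suc v \<longrightarrow> v = q i))"
      if "a \<in> D" "\<delta> p a" for a p
      using h(2)[OF that] unfolding t2_out_def pcode_eq_list_encode_pre by blast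
  qed
qed

lemma rho_rep_computableE:
  fixes f :: "'a \<Rightarrow> real ^ 'm::finite"
  assumes "fn_computable \<delta> rho_rep D f"
  obtains F where "computable (\<lambda>z. F (fst z) (snd z))"
    "\<And>a p i. a \<in> D \<Longrightarrow> \<delta> p a \<Longrightarrow> \<exists>n v. F i (pre p n) = Suc v"
    "\<And>a p i n v. a \<in> D \<Longrightarrow> \<delta> p a \<Longrightarrow> F i (pre p n) = Suc v \<Longrightarrow> dist (vec_dec v) (f a) < inverse (2 ^ i)"
proof -
  obtain M where M: "computable (\<lambda>z. M (fst z) (snd z))"
    "\<And>a p. a \<in> D \<Longrightarrow> \<delta> p a \<Longrightarrow> \<exists>q. \<exists>b\<in>{f a}. rho_rep q b \<and>
      (\<forall>i. (\<exists>n. M i (pre p n) = Suc (q i)) \<and> (\<forall>n v. M i (pre p n) = Suc v \<longrightarrow> v = q i))"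
    using mv_computableE[OF assms[unfolded fn_computable_def]] by blast
  show thesis
  proof (rule that[OF M(1)])
    show "\<exists>n v. M i (pre p n) = Suc v" if "a \<in> D" "\<delta> p a" for a p i
      using M(2)[OF that] by blast
    show "dist (vec_dec v) (f a) < inverse (2 ^ i)"
      if "a \<in> D" "\<delta> p a" "M i (pre p n) = Suc v" for a p i n v
      using M(2)[OF that(1,2)] that(3) unfolding rho_rep_def by blast
  qed
qed

lemma nu_rep_computableE:
  assumes "mv_computable \<delta> nu_rep D H"
  obtains M where "computable M"
    "\<And>a p. a \<in> D \<Longrightarrow> \<delta> p a \<Longrightarrow> \<exists>n l. M (pre p n) = Suc l"
    "\<And>a p n l. a \<in> D \<Longrightarrow> \<delta> p a \<Longrightarrow> M (pre p n) = Suc l \<Longrightarrow> l \<in> H a"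
proof -
  obtain M where M: "computable (\<lambda>z. M (fst z) (snd z))"
    "\<And>a p. a \<in> D \<Longrightarrow> \<delta> p a \<Longrightarrow> \<exists>q. \<exists>b\<in>H a. nu_rep q b \<and>
      (\<forall>i. (\<exists>n. M i (pre p n) = Suc (q i)) \<and> (\<forall>n v. M i (pre p n) = Suc v \<longrightarrow> v = q i))"
    using mv_computableE[OF assms] by blast
  show thesis
  proof (rule that[of "M 0"])
    show "computable (M 0)"
      using computable_comp2[OF M(1) computable_const computable_id, of 0] by simp
    show "\<exists>n l. M 0 (pre p n) = Suc l" if "a \<in> D" "\<delta> p a" for a p
      using M(2)[OF that] by blast
    show "l \<in> H a" if "a \<in> D" "\<delta> p a" "M 0 (pre p n) = Suc l" for a p n l
      using M(2)[OF that(1,2)] that(3) unfolding nu_rep_def by blast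
  qed
qed

section \<open>Names of points and pairs, computable sequences\<close>

lemma rho_rep_ex:
  fixes x :: "real ^ 'n::finite"
  obtains p where "rho_rep p x"
proof -
  have "\<forall>k. \<exists>c. dist (vec_dec c) x < inverse (2 ^ k)" by (intro allI ex_vec_dec_near) simp
  then show thesis using that unfolding rho_rep_def by metis
qed

text \<open>Filling every odd position with \<open>k\<close> keeps the construction local: the first
  \<open>n\<close> symbols depend on at most the first \<open>n\<close> symbols of \<open>p\<close>,
  so a machine can form them from a prefix.\<close>

definition pair_const :: "name \<Rightarrow> nat \<Rightarrow> name" where
  "pair_const p k j = (if even j then p (j div 2) else k)"

lemma pair_rep_pair_const: "rho_rep p x \<Longrightarrow> pair_rep rho_rep nu_rep (pair_const p k) (x, k)"
  by (simp add: pair_rep_def pair_const_def nu_rep_def)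

lemma pair_rep_nuD: "pair_rep \<delta> nu_rep p (x, k) \<Longrightarrow> p 1 = k"
  by (simp add: pair_rep_def nu_rep_def)

lemma pair_rep_fstD: "pair_rep \<delta> \<delta>' p (x, k) \<Longrightarrow> \<delta> (\<lambda>i. p (2 * i)) x"
  by (simp add: pair_rep_def)

lemma pre_pair_const_cong:
  assumes "\<And>i. i < n \<Longrightarrow> p i = q i" shows "pre (pair_const p k) n = pre (pair_const q k) n"
  by (rule pre_cong) (simp add: pair_const_def assms)

lemma computable_pair_const [computable_intros]:
  fixes n :: "'a::surj_encodable \<Rightarrow> nat"
  assumes "computable (\<lambda>z. P (fst z) (snd z))" "computable k" "computable n"
  shows "computable (\<lambda>e. pair_const (P e) (k e) (n e))"
  unfolding pair_const_def by (intro computable_intros computable_comp2[OF assms(1)] assms)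

text \<open>The input \<open>j\<close> has the computable name \<open>\<lambda>_. j\<close>. Waiting
  for the machine on that name is a terminating search, which removes names from the description of
  a computable sequence.\<close>

lemma nu_rho_computable_iff:
  fixes g :: "nat \<Rightarrow> real ^ 'm::finite"
  shows "fn_computable nu_rep rho_rep UNIV g \<longleftrightarrow> (\<exists>V. computable (\<lambda>z. V (fst z) (snd z)) \<and>
    (\<forall>j k. dist (vec_dec (V j k)) (g j) < inverse (2 ^ k)))" (is "?l \<longleftrightarrow> ?r")
proof
  assume ?l
  then obtain F where F: "computable (\<lambda>z. F (fst z) (snd z))"
    "\<And>a p i. nu_rep p a \<Longrightarrow> \<exists>n v. F i (pre p n) = Suc v"
    "\<And>a p i n v. nu_rep p a \<Longrightarrow> F i (pre p n) = Suc v \<Longrightarrow> dist (vec_dec v) (g a) < inverse (2 ^ i)"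
    using rho_rep_computableE[of nu_rep UNIV g] by (metis UNIV_I)
  define n where "n j k = (LEAST n. F k (pre (\<lambda>_. j) n) \<noteq> 0)" for j k
  have nu: "nu_rep (\<lambda>_. j) j" for j by (simp add: nu_rep_def)
  have ex: "\<exists>n. F k (pre (\<lambda>_. j) n) \<noteq> 0" for j k using F(2)[OF nu, of k j] by (metis nat.distinct(1))
  have "computable (\<lambda>z. n (fst z) (snd z))"
    unfolding n_def by (intro computable_intros computable_comp2[OF F(1)] ex)
  then have "computable (\<lambda>z. F (snd z) (pre (\<lambda>_. fst z) (n (fst z) (snd z))) - 1)"
    by (intro computable_intros computable_comp2[OF F(1)])
  moreover have "dist (vec_dec (F k (pre (\<lambda>_. j) (n j k)) - 1)) (g j) < inverse (2 ^ k)" for j k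
  proof -
    have "F k (pre (\<lambda>_. j) (n j k)) \<noteq> 0" unfolding n_def by (rule LeastI_ex[OF ex])
    then show ?thesis using F(3)[OF nu, of k j "n j k"] by simp
  qed
  ultimately show ?r by (intro exI[of _ "\<lambda>j k. F k (pre (\<lambda>_. j) (n j k)) - 1"]) simp
next
  assume ?r
  then obtain V where V: "computable (\<lambda>z. V (fst z) (snd z))"
    "\<And>j k. dist (vec_dec (V j k)) (g j) < inverse (2 ^ k)" by blast
  show ?l
    unfolding fn_computable_def
  proof (rule mv_computableI)
    show "computable (\<lambda>z :: nat \<times> nat list \<times> nat list. if 0 < length (snd (snd z))
      then Suc (V (nth0 (snd (snd z)) 0) (fst z)) else 0)"
      by (intro computable_intros computable_comp2[OF V(1)])
    show "\<exists>t n. (if 0 < length (pre p n) then Suc (V (nth0 (pre p n) 0) i) else 0) \<noteq> 0" for p i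
      by (rule exI, rule exI[of _ 1]) simp
    show "\<exists>b\<in>{g a}. rho_rep q b" if "nu_rep p a"
      "\<And>i. \<exists>t n. (if 0 < length (pre p n) then Suc (V (nth0 (pre p n) 0) i) else 0) = Suc (q i)" for a p q
    proof -
      have "V a i = q i" for i
        using that(2)[of i] that(1) by (auto simp: nu_rep_def split: if_splits)
      then show ?thesis using V(2)[of a] by (simp add: rho_rep_def)
    qed
  qed
qed

text \<open>\<open>V j\<close> is a computable name of \<open>xs j\<close>, so waiting for the
  machine of \<open>f\<close> on it is again a terminating search.\<close>

lemma computable_along_computable_sequence:
  fixes xs :: "nat \<Rightarrow> real ^ 'n::finite" and f :: "real ^ 'n \<Rightarrow> real ^ 'm::finite"
  assumes "fn_computable nu_rep rho_rep UNIV xs" "range xs \<subseteq> X" "fn_computable rho_rep rho_rep X f"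
  shows "fn_computable nu_rep rho_rep UNIV (\<lambda>j. f (xs j))"
proof -
  obtain V where V: "computable (\<lambda>z. V (fst z) (snd z))"
    "\<And>j k. dist (vec_dec (V j k)) (xs j) < inverse (2 ^ k)"
    using assms(1) unfolding nu_rho_computable_iff by blast
  obtain F where F: "computable (\<lambda>z. F (fst z) (snd z))"
    "\<And>x p i. x \<in> X \<Longrightarrow> rho_rep p x \<Longrightarrow> \<exists>n v. F i (pre p n) = Suc v"
    "\<And>x p i n v. x \<in> X \<Longrightarrow> rho_rep p x \<Longrightarrow> F i (pre p n) = Suc v \<Longrightarrow> dist (vec_dec v) (f x) < inverse (2 ^ i)"
    using rho_rep_computableE[OF assms(3)] by blast
  define n where "n j k = (LEAST n. F k (pre (V j) n) \<noteq> 0)" for j k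
  have nm: "rho_rep (V j) (xs j)" for j using V(2) by (simp add: rho_rep_def)
  have X: "xs j \<in> X" for j using assms(2) by auto
  have ex: "\<exists>n. F k (pre (V j) n) \<noteq> 0" for j k using F(2)[OF X nm, of k j] by (metis nat.distinct(1))
  have "computable (\<lambda>z. n (fst z) (snd z))"
    unfolding n_def by (intro computable_intros computable_comp2[OF F(1)] computable_comp2[OF V(1)] ex)
  then have "computable (\<lambda>z. F (snd z) (pre (V (fst z)) (n (fst z) (snd z))) - 1)"
    by (intro computable_intros computable_comp2[OF F(1)] computable_comp2[OF V(1)])
  moreover have "dist (vec_dec (F k (pre (V j) (n j k)) - 1)) (f (xs j)) < inverse (2 ^ k)" for j k
  proof -
    have "F k (pre (V j) (n j k)) \<noteq> 0" unfolding n_def by (rule LeastI_ex[OF ex])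
    then show ?thesis using F(3)[OF X nm, of k j "n j k"] by simp
  qed
  ultimately show ?thesis
    unfolding nu_rho_computable_iff by (intro exI[of _ "\<lambda>j k. F k (pre (V j) (n j k)) - 1"]) simp
qed

section \<open>Modulus of continuity\<close>

lemma ex_inverse_power2_less:
  assumes "0 < (d :: real)" shows "\<exists>l. inverse (2 ^ l) < d"
proof -
  obtain l where "(1 / 2 :: real) ^ l < d" using real_arch_pow_inv[OF assms, of "1/2"] by auto
  then show ?thesis by (auto simp: power_one_over inverse_eq_divide)
qed

text \<open>Applied to a prefix of a name of \<open>x\<close>: its finitely many strict inequalities
  have a common slack, so the prefix also starts a name of every point close enough to
  \<open>x\<close>.\<close>

lemma ex_uniform_gap:
  fixes a b :: "nat \<Rightarrow> real"
  shows "(\<And>i. i < N \<Longrightarrow> a i < b i) \<Longrightarrow> \<exists>d>0. \<forall>i<N. a i + d \<le> b i"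
proof (induction N)
  case 0
  then show ?case by (auto intro: exI[of _ 1])
next
  case (Suc N)
  then obtain d where d: "d > 0" "\<And>i. i < N \<Longrightarrow> a i + d \<le> b i" by (meson less_SucI)
  define d' where "d' = min d (b N - a N)"
  have "d' > 0" using d(1) Suc.prems[of N] by (simp add: d'_def)
  moreover have "a i + d' \<le> b i" if "i < Suc N" for i
    using that d(2)[of i] by (cases "i = N") (auto simp: d'_def)
  ultimately show ?case by blast
qed

text \<open>Gives a point near \<open>x\<close> a name that a machine cannot tell from the name
  \<open>p\<close> of \<open>x\<close> within \<open>N\<close> symbols.\<close>

definition splice_name :: "name \<Rightarrow> nat \<Rightarrow> name \<Rightarrow> name" where
  "splice_name p N r i = (if i < N then p i else r i)"

lemma pre_splice_name [simp]: "pre (splice_name p N r) N = pre p N"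
  by (rule pre_cong) (simp add: splice_name_def)

lemma rho_rep_splice_name:
  "rho_rep r x \<Longrightarrow> (\<And>i. i < N \<Longrightarrow> dist (vec_dec (p i)) x < inverse (2 ^ i)) \<Longrightarrow> rho_rep (splice_name p N r) x"
  by (simp add: rho_rep_def splice_name_def)

text \<open>The value set contains all valid exponents, so that the machine is free to return any
  one it can certify.\<close>

lemma computable_modulus_of_continuity:
  fixes f :: "real ^ 'n::finite \<Rightarrow> real ^ 'm::finite"
  assumes "fn_computable rho_rep rho_rep X f"
  shows "mv_computable (pair_rep rho_rep nu_rep) nu_rep (X \<times> UNIV)
    (\<lambda>(x, k). {l. f ` (ball x (inverse (2 ^ l)) \<inter> X) \<subseteq> ball (f x) (inverse (2 ^ k))})"
proof -
  obtain F where F: "computable (\<lambda>z. F (fst z) (snd z))"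
    "\<And>x p i. x \<in> X \<Longrightarrow> rho_rep p x \<Longrightarrow> \<exists>n v. F i (pre p n) = Suc v"
    "\<And>x p i n v. x \<in> X \<Longrightarrow> rho_rep p x \<Longrightarrow> F i (pre p n) = Suc v \<Longrightarrow> dist (vec_dec v) (f x) < inverse (2 ^ i)"
    using rho_rep_computableE[OF assms] by blast
  \<comment> \<open>In the certificate \<open>t = [N, l]\<close>, \<open>F\<close> has answered with
    precision \<open>k + 1\<close> after \<open>N\<close> symbols of the name of \<open>x\<close>,
    and \<open>nth0 w 1\<close> is \<open>k\<close>. One 2^-l of the margin pays for replacing
    \<open>x\<close> by its \<open>l\<close>-th approximation, the other for moving from
    \<open>x\<close> to a point of the ball.\<close>
  define G :: "nat \<Rightarrow> nat list \<Rightarrow> nat list \<Rightarrow> nat" where "G i t w =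
    (if 2 * nth0 t 0 < length w \<and> 2 * nth0 t 1 < length w \<and> 1 < length w \<and>
        F (Suc (nth0 w 1)) (pre (\<lambda>i. nth0 w (2 * i)) (nth0 t 0)) \<noteq> 0 \<and>
        (\<forall>i<nth0 t 0. dist (vec_dec (nth0 w (2 * i)) :: real ^ 'n) (vec_dec (nth0 w (2 * nth0 t 1)))
            < inverse (2 ^ i) - 2 * inverse (2 ^ nth0 t 1))
      then Suc (nth0 t 1) else 0)" for i t w
  have G_eq: "G i t (pre p n) =
    (if 2 * N < n \<and> 2 * l < n \<and> 1 < n \<and> F (Suc (p 1)) (pre (\<lambda>i. p (2 * i)) N) \<noteq> 0 \<and>
        (\<forall>i<N. dist (vec_dec (p (2 * i)) :: real ^ 'n) (vec_dec (p (2 * l)))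
            < inverse (2 ^ i) - 2 * inverse (2 ^ l))
      then Suc l else 0)" if "N = nth0 t 0" "l = nth0 t 1" for i t p n N l
  proof -
    have "pre (\<lambda>i. nth0 (pre p n) (2 * i)) N = pre (\<lambda>i. p (2 * i)) N" if "2 * N < n"
      using that by (intro pre_cong) simp
    then show ?thesis unfolding G_def that[symmetric] by auto
  qed
  show ?thesis
  proof (rule mv_computableI)
    show "computable (\<lambda>z. G (fst z) (fst (snd z)) (snd (snd z)))"
      unfolding G_def by (intro computable_intros computable_comp2[OF F(1)])
  next
    fix a p i assume "a \<in> X \<times> (UNIV :: nat set)" "pair_rep rho_rep nu_rep p a"
    then obtain x k where a: "x \<in> X" "pair_rep rho_rep nu_rep p (x, k)" by auto
    have nm: "rho_rep (\<lambda>i. p (2 * i)) x" using a(2) by (rule pair_rep_fstD)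
    obtain N v where N: "F (Suc (p 1)) (pre (\<lambda>i. p (2 * i)) N) = Suc v"
      using F(2)[OF a(1) nm] by blast
    obtain d where d: "d > 0" "\<And>i. i < N \<Longrightarrow> dist (vec_dec (p (2 * i))) x + d \<le> inverse (2 ^ i)"
      using ex_uniform_gap[of N "\<lambda>i. dist (vec_dec (p (2 * i))) x" "\<lambda>i. inverse (2 ^ i)"] nm
      unfolding rho_rep_def by blast
    \<comment> \<open>A third, because the error of the \<open>l\<close>-th approximation adds one
      2^-l to the two of the margin.\<close>
    obtain l where l: "inverse (2 ^ l) < d / 3" using ex_inverse_power2_less[of "d / 3"] d(1) by auto
    have "dist (vec_dec (p (2 * i)) :: real ^ 'n) (vec_dec (p (2 * l)))
            < inverse (2 ^ i) - 2 * inverse (2 ^ l)" if "i < N" for i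
      using d(2)[OF that] l nm[unfolded rho_rep_def, rule_format, of l]
        dist_triangle2[of "vec_dec (p (2 * i)) :: real ^ 'n" "vec_dec (p (2 * l))" x]
      by (simp add: dist_commute)
    then have "G i [N, l] (pre p (2 * N + 2 * l + 2)) \<noteq> 0"
      using N by (subst G_eq[of N _ l]) (auto simp: nth0_def)
    then show "\<exists>t n. G i t (pre p n) \<noteq> 0" by blast
  next
    fix a p q assume "a \<in> X \<times> (UNIV :: nat set)" "pair_rep rho_rep nu_rep p a"
      and q: "\<And>i. \<exists>t n. G i t (pre p n) = Suc (q i)"
    then obtain x k where a: "a = (x, k)" "x \<in> X" "pair_rep rho_rep nu_rep p (x, k)" by auto
    have nm: "rho_rep (\<lambda>i. p (2 * i)) x" using a(3) by (rule pair_rep_fstD)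
    obtain t n where "G 0 t (pre p n) = Suc (q 0)" using q by blast
    moreover define N l where "N = nth0 t 0" and "l = nth0 t 1"
    ultimately have N: "F (Suc (p 1)) (pre (\<lambda>i. p (2 * i)) N) \<noteq> 0" and "q 0 = l"
      and gap: "\<And>i. i < N \<Longrightarrow> dist (vec_dec (p (2 * i)) :: real ^ 'n) (vec_dec (p (2 * l)))
            < inverse (2 ^ i) - 2 * inverse (2 ^ l)"
      by (auto simp: G_eq[of N t l] split: if_splits)
    obtain v where "F (Suc (p 1)) (pre (\<lambda>i. p (2 * i)) N) = Suc v" using N not0_implies_Suc by blast
    then have v: "F (Suc k) (pre (\<lambda>i. p (2 * i)) N) = Suc v" using pair_rep_nuD[OF a(3)] by simp
    have "dist (f x) (f y) < inverse (2 ^ k)" if y: "y \<in> X" "dist x y < inverse (2 ^ l)" for y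
    proof -
      obtain r where r: "rho_rep r y" by (rule rho_rep_ex)
      have "rho_rep (splice_name (\<lambda>i. p (2 * i)) N r) y"
      proof (rule rho_rep_splice_name[OF r])
        fix i assume "i < N"
        have "dist (vec_dec (p (2 * l))) x < inverse (2 ^ l)" using nm by (simp add: rho_rep_def)
        then show "dist (vec_dec (p (2 * i))) y < inverse (2 ^ i)"
          using gap[OF \<open>i < N\<close>] y(2)
            dist_triangle[of "vec_dec (p (2 * i))" y "vec_dec (p (2 * l)) :: real ^ 'n"]
            dist_triangle[of "vec_dec (p (2 * l))" y x] by simp
      qed
      \<comment> \<open>Both \<open>x\<close> and \<open>y\<close> have a name with this prefix, so
        the single answer \<open>v\<close> lies within 2^-(k+1) of \<open>f x\<close> and of
        \<open>f y\<close>.\<close>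
      from F(3)[OF y(1) this, of "Suc k" N v] F(3)[OF a(2) nm v] v
      show ?thesis using dist_triangle3[of "f x" "f y" "vec_dec v"] by simp
    qed
    then show "\<exists>b\<in>(case a of (x, k) \<Rightarrow> {l. f ` (ball x (inverse (2 ^ l)) \<inter> X)
        \<subseteq> ball (f x) (inverse (2 ^ k))}). nu_rep q b"
      using \<open>q 0 = l\<close> by (auto simp: a(1) nu_rep_def)
  qed
qed

lemma mv_computable_nonempty:
  "mv_computable \<delta> \<delta>' D H \<Longrightarrow> a \<in> D \<Longrightarrow> \<delta> p a \<Longrightarrow> H a \<noteq> {}"
  unfolding mv_computable_def by blast

text \<open>A machine for the modulus of continuity returns some value at every point, and that
  value is a radius for the usual definition.\<close>

lemma computable_imp_continuous:
  fixes f :: "real ^ 'n::finite \<Rightarrow> real ^ 'm::finite"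
  assumes "fn_computable rho_rep rho_rep X f" "x \<in> X" "0 < e"
  obtains d where "0 < d" "\<And>y. y \<in> X \<Longrightarrow> dist x y < d \<Longrightarrow> dist (f x) (f y) < e"
proof -
  obtain k where k: "inverse (2 ^ k) < e" using ex_inverse_power2_less[OF assms(3)] by blast
  obtain p where "rho_rep p x" by (rule rho_rep_ex)
  then have "pair_rep rho_rep nu_rep (pair_const p k) (x, k)" by (rule pair_rep_pair_const)
  then obtain l where l: "f ` (ball x (inverse (2 ^ l)) \<inter> X) \<subseteq> ball (f x) (inverse (2 ^ k))"
    using mv_computable_nonempty[OF computable_modulus_of_continuity[OF assms(1)],
        of "(x, k)" "pair_const p k"] assms(2) by auto
  show thesis
  proof (rule that[of "inverse (2 ^ l)"])
    show "dist (f x) (f y) < e" if "y \<in> X" "dist x y < inverse (2 ^ l)" for y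
      using l that k by (force simp: image_subset_iff)
  qed simp
qed

text \<open>If \<open>xs j\<close> is within 2^-l of \<open>x\<close> for a modulus \<open>l\<close>
  at precision \<open>i + 1\<close>, then an approximation of \<open>f (xs j)\<close> with error
  2^-(i+1) is one of \<open>f x\<close> with error 2^-i. Any such \<open>j\<close> will do.\<close>

lemma computable_of_modulus_of_continuity:
  fixes f :: "real ^ 'n::finite \<Rightarrow> real ^ 'm::finite"
  assumes xs: "fn_computable nu_rep rho_rep UNIV xs" "range xs \<subseteq> X" "X \<subseteq> closure (range xs)"
    and fxs: "fn_computable nu_rep rho_rep UNIV (\<lambda>j. f (xs j))"
    and moc: "mv_computable (pair_rep rho_rep nu_rep) nu_rep (X \<times> UNIV) (\<lambda>(x, k). moc x k)"
    "\<And>x k l. x \<in> X \<Longrightarrow> l \<in> moc x k \<Longrightarrow> f ` (ball x (inverse (2 ^ l)) \<inter> X) \<subseteq> ball (f x) (inverse (2 ^ k))"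
  shows "fn_computable rho_rep rho_rep X f"
proof -
  obtain V where V: "computable (\<lambda>z. V (fst z) (snd z))"
    "\<And>j k. dist (vec_dec (V j k)) (xs j) < inverse (2 ^ k)"
    using xs(1) unfolding nu_rho_computable_iff by blast
  obtain W where W: "computable (\<lambda>z. W (fst z) (snd z))"
    "\<And>j k. dist (vec_dec (W j k)) (f (xs j)) < inverse (2 ^ k)"
    using fxs unfolding nu_rho_computable_iff by blast
  obtain M where M: "computable M"
    "\<And>a p. a \<in> X \<times> UNIV \<Longrightarrow> pair_rep rho_rep nu_rep p a \<Longrightarrow> \<exists>n l. M (pre p n) = Suc l"
    "\<And>a p n l. a \<in> X \<times> UNIV \<Longrightarrow> pair_rep rho_rep nu_rep p a \<Longrightarrow> M (pre p n) = Suc l \<Longrightarrow>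
      l \<in> (case a of (x, k) \<Rightarrow> moc x k)"
    using nu_rep_computableE[OF moc(1)] by blast
  \<comment> \<open>In \<open>t = [N, j, L]\<close>, the modulus is known after \<open>N\<close>
    symbols and \<open>xs j\<close> is compared with \<open>x\<close> at precision \<open>L\<close>.
    The margin \<open>2 * 2^-L\<close> pays for knowing each of the two points only up to
    2^-L.\<close>
  define G :: "nat \<Rightarrow> nat list \<Rightarrow> nat list \<Rightarrow> nat" where "G i t w =
    (if nth0 t 0 \<le> length w \<and> nth0 t 2 < length w \<and>
        M (pre (pair_const (nth0 w) (Suc i)) (nth0 t 0)) \<noteq> 0 \<and>
        dist (vec_dec (nth0 w (nth0 t 2)) :: real ^ 'n) (vec_dec (V (nth0 t 1) (nth0 t 2)))
          < inverse (2 ^ (M (pre (pair_const (nth0 w) (Suc i)) (nth0 t 0)) - 1))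
            - 2 * inverse (2 ^ nth0 t 2)
      then Suc (W (nth0 t 1) (Suc i)) else 0)" for i t w
  have G_eq: "G i t (pre p n) =
    (if N \<le> n \<and> L < n \<and> M (pre (pair_const p (Suc i)) N) \<noteq> 0 \<and>
        dist (vec_dec (p L) :: real ^ 'n) (vec_dec (V j L))
          < inverse (2 ^ (M (pre (pair_const p (Suc i)) N) - 1)) - 2 * inverse (2 ^ L)
      then Suc (W j (Suc i)) else 0)"
    if "N = nth0 t 0" "j = nth0 t 1" "L = nth0 t 2" for i t p n N j L
  proof -
    have "pre (pair_const (nth0 (pre p n)) (Suc i)) N = pre (pair_const p (Suc i)) N" if "N \<le> n"
      using that by (intro pre_pair_const_cong) simp
    then show ?thesis unfolding G_def that[symmetric] by auto
  qed
  show ?thesis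
    unfolding fn_computable_def
  proof (rule mv_computableI)
    show "computable (\<lambda>z. G (fst z) (fst (snd z)) (snd (snd z)))"
      unfolding G_def
      by (intro computable_intros computable_comp[OF M(1)] computable_comp2[OF V(1)]
          computable_comp2[OF W(1)])
  next
    fix x p i assume x: "x \<in> X" "rho_rep p x"
    have nm: "pair_rep rho_rep nu_rep (pair_const p (Suc i)) (x, Suc i)"
      using x(2) by (rule pair_rep_pair_const)
    obtain N l where l: "M (pre (pair_const p (Suc i)) N) = Suc l"
      using M(2)[OF _ nm] x(1) by auto
    obtain j where j: "dist (xs j) x < inverse (2 ^ l)"
      using xs(3) x(1) unfolding closure_approachable[of x "range xs"] subset_iff
      by (metis closure_approachable imageE positive_imp_inverse_positive zero_less_numeral
          zero_less_power)
    define d where "d = inverse (2 ^ l) - dist (xs j) x"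
    have "d > 0" using j by (simp add: d_def)
    \<comment> \<open>Besides the margin, the two approximation errors enter once more: four times
      2^-L in all.\<close>
    then obtain L where L: "inverse (2 ^ L) < d / 4" using ex_inverse_power2_less[of "d / 4"] by auto
    have "dist (vec_dec (p L)) x < inverse (2 ^ L)" using x(2) by (simp add: rho_rep_def)
    then have "dist (vec_dec (p L) :: real ^ 'n) (vec_dec (V j L)) < inverse (2 ^ l) - 2 * inverse (2 ^ L)"
      using V(2)[of j L] L dist_triangle[of "vec_dec (p L) :: real ^ 'n" "vec_dec (V j L)" x]
        dist_triangle[of x "vec_dec (V j L)" "xs j"]
      by (simp add: d_def dist_commute)
    then have "G i [N, j, L] (pre p (N + L + 1)) \<noteq> 0"
      using l by (subst G_eq[of N _ j L]) (auto simp: nth0_def)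
    then show "\<exists>t n. G i t (pre p n) \<noteq> 0" by blast
  next
    fix x p q assume x: "x \<in> X" "rho_rep p x" and q: "\<And>i. \<exists>t n. G i t (pre p n) = Suc (q i)"
    have "dist (vec_dec (q i)) (f x) < inverse (2 ^ i)" for i
    proof -
      have nm: "pair_rep rho_rep nu_rep (pair_const p (Suc i)) (x, Suc i)"
        using x(2) by (rule pair_rep_pair_const)
      obtain t n where "G i t (pre p n) = Suc (q i)" using q by blast
      moreover define N j L where "N = nth0 t 0" and "j = nth0 t 1" and "L = nth0 t 2"
      moreover define l where "l = M (pre (pair_const p (Suc i)) N) - 1"
      ultimately have N: "M (pre (pair_const p (Suc i)) N) = Suc l" and q_eq: "q i = W j (Suc i)"
        and less: "dist (vec_dec (p L) :: real ^ 'n) (vec_dec (V j L)) < inverse (2 ^ l) - 2 * inverse (2 ^ L)"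
        by (auto simp: G_eq[of N t j L] split: if_splits)
      have "l \<in> moc x (Suc i)" using M(3)[OF _ nm N] x(1) by simp
      moreover have "dist (vec_dec (p L)) x < inverse (2 ^ L)" using x(2) by (simp add: rho_rep_def)
      then have "dist x (xs j) < inverse (2 ^ l)"
        using less V(2)[of j L] dist_triangle[of x "xs j" "vec_dec (p L)"]
          dist_triangle[of "vec_dec (p L)" "xs j" "vec_dec (V j L)"]
        by (simp add: dist_commute)
      ultimately have "dist (f x) (f (xs j)) < inverse (2 ^ Suc i)"
        using moc(2)[of x l "Suc i"] x(1) xs(2) by (auto simp: image_subset_iff)
      then show ?thesis
        using W(2)[of j "Suc i"] dist_triangle[of "vec_dec (q i)" "f x" "f (xs j)"]
        by (simp add: q_eq dist_commute)
    qed
    then show "\<exists>b\<in>{f x}. rho_rep q b" by (simp add: rho_rep_def)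
  qed
qed

section \<open>Modulus of openness\<close>

text \<open>The machine waits until a rational lower bound of \<open>Moo\<close> exceeds some 2^-l;
  positivity of \<open>Moo\<close> ensures that this happens.\<close>

lemma computable_modulus_of_openness:
  fixes f :: "real ^ 'n::finite \<Rightarrow> real ^ 'm::finite"
  assumes pos: "\<And>x k. x \<in> X \<Longrightarrow> Moo X f x k > 0"
    and comp: "fn_computable (pair_rep rho_rep nu_rep) rhol_rep (X \<times> UNIV) (\<lambda>(x, k). Moo X f x k)"
  shows "mv_computable (pair_rep rho_rep nu_rep) nu_rep (X \<times> UNIV)
    (\<lambda>(x, k). {l. ball (f x) (inverse (2 ^ l)) \<subseteq> f ` (ball x (inverse (2 ^ k)) \<inter> X)})"
proof -
  obtain M where M: "computable (\<lambda>z. M (fst z) (snd z))"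
    "\<And>a p. a \<in> X \<times> UNIV \<Longrightarrow> pair_rep rho_rep nu_rep p a \<Longrightarrow>
      \<exists>q. \<exists>b\<in>{case a of (x, k) \<Rightarrow> Moo X f x k}. rhol_rep q b \<and>
      (\<forall>i. (\<exists>n. M i (pre p n) = Suc (q i)) \<and> (\<forall>n v. M i (pre p n) = Suc v \<longrightarrow> v = q i))"
    using mv_computableE[OF comp[unfolded fn_computable_def]] by blast
  define G :: "nat \<Rightarrow> nat list \<Rightarrow> nat list \<Rightarrow> nat" where "G i t w =
    (if M (nth0 t 0) w \<noteq> 0 \<and> inverse (2 ^ nth0 t 1) < rat_dec (M (nth0 t 0) w - 1)
     then Suc (nth0 t 1) else 0)" for i t w
  show ?thesis
  proof (rule mv_computableI)
    show "computable (\<lambda>z. G (fst z) (fst (snd z)) (snd (snd z)))"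
      unfolding G_def by (intro computable_intros computable_comp2[OF M(1)])
  next
    fix a p i assume "a \<in> X \<times> (UNIV :: nat set)" "pair_rep rho_rep nu_rep p a"
    then obtain x k q where x: "x \<in> X" and q: "rhol_rep q (Moo X f x k)"
      "\<And>i. \<exists>n. M i (pre p n) = Suc (q i)"
      using M(2) by (cases a) fastforce
    obtain j where j: "0 < rat_dec (q j)"
      using q(1) pos[OF x, of k] unfolding rhol_rep_def by (force simp: zero_ereal_def)
    obtain l where "inverse (2 ^ l) < rat_dec (q j)" using ex_inverse_power2_less[OF j] by blast
    moreover obtain n where "M j (pre p n) = Suc (q j)" using q(2) by blast
    ultimately have "G i [j, l] (pre p n) \<noteq> 0" by (simp add: G_def nth0_def)
    then show "\<exists>t n. G i t (pre p n) \<noteq> 0" by blast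
  next
    fix a p q assume *: "a \<in> X \<times> (UNIV :: nat set)" "pair_rep rho_rep nu_rep p a"
      and G: "\<And>i. \<exists>t n. G i t (pre p n) = Suc (q i)"
    then obtain x k r where a: "a = (x, k)" "x \<in> X" and r: "rhol_rep r (Moo X f x k)"
      "\<And>i n v. M i (pre p n) = Suc v \<Longrightarrow> v = r i"
      using M(2)[OF *] by (cases a) fastforce
    obtain t n where "G 0 t (pre p n) = Suc (q 0)" using G by blast
    then obtain j where "M j (pre p n) \<noteq> 0" "inverse (2 ^ q 0) < rat_dec (M j (pre p n) - 1)"
      by (auto simp: G_def split: if_splits)
    then have "inverse (2 ^ q 0) < rat_dec (r j)" using r(2)[of j n "M j (pre p n) - 1"] by simp
    then have "ereal (inverse (2 ^ q 0)) < ereal (rat_dec (r j))" by simp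
    also have "\<dots> < Moo X f x k" using r(1) by (simp add: rhol_rep_def)
    \<comment> \<open>The supremum need not be attained, but what lies strictly below it lies below
      an admissible radius.\<close>
    finally obtain s where "inverse (2 ^ q 0) < s"
      "cball (f x) s \<subseteq> f ` (ball x (inverse (2 ^ k)) \<inter> X)"
      unfolding Moo_def less_Sup_iff by auto
    then have "ball (f x) (inverse (2 ^ q 0)) \<subseteq> f ` (ball x (inverse (2 ^ k)) \<inter> X)"
      by (meson ball_subset_cball less_imp_le order_trans subset_ball)
    then show "\<exists>b\<in>(case a of (x, k) \<Rightarrow> {l. ball (f x) (inverse (2 ^ l))
        \<subseteq> f ` (ball x (inverse (2 ^ k)) \<inter> X)}). nu_rep q b"
      by (simp add: a(1) nu_rep_def)
  qed
qed

section \<open>From a modulus of openness to effective openness\<close>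

definition theta_ball :: "nat \<Rightarrow> (real ^ 'n::finite) set" where
  "theta_ball s = (if s = 0 then {}
    else ball (vec_dec (fst (prod_decode (s - 1)))) (rat_dec (snd (prod_decode (s - 1)))))"

lemma theta_rep_iff: "theta_rep p U \<longleftrightarrow> U = (\<Union>k. theta_ball (p k))"
  by (simp add: theta_rep_def theta_ball_def case_prod_beta)

lemma theta_ball_Suc_prod_encode [simp]:
  "theta_ball (Suc (prod_encode (c, r))) = ball (vec_dec c) (rat_dec r)"
  by (simp add: theta_ball_def)

text \<open>Names of this form are finite data, so a machine can run through all of them and try
  other machines on them.\<close>

definition eventually_const :: "nat list \<Rightarrow> nat \<Rightarrow> name" where
  "eventually_const u c m = (if m < length u then nth0 u m else c)"

lemma rho_rep_eventually_const:
  assumes "\<And>m. m < length u \<Longrightarrow> dist (vec_dec (nth0 u m)) (vec_dec c :: real ^ 'n::finite) < inverse (2 ^ m)"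
  shows "rho_rep (eventually_const u c) (vec_dec c :: real ^ 'n)"
  using assms by (simp add: rho_rep_def eventually_const_def)

text \<open>Since an arbitrary name of a point is not available to a machine that is only given an open set,
  the modulus is run on names of rational points. Their first symbols \<open>u\<close> are varied as well:
  a long enough prefix \<open>u\<close> of a name of \<open>z\<close> forces the same modulus for all rational points
  near \<open>z\<close>, so that the balls found reach \<open>f z\<close>.\<close>

lemma eff_open_of_modulus_of_openness:
  fixes f :: "real ^ 'n::finite \<Rightarrow> real ^ 'm::finite"
  assumes f: "fn_computable rho_rep rho_rep X f"
    and moo: "mv_computable (pair_rep rho_rep nu_rep) nu_rep (X \<times> UNIV) (\<lambda>(x, k). moo x k)"
    "\<And>x k l. x \<in> X \<Longrightarrow> l \<in> moo x k \<Longrightarrow> ball (f x) (inverse (2 ^ l)) \<subseteq> f ` (ball x (inverse (2 ^ k)) \<inter> X)"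
  shows "eff_open X f"
proof -
  obtain F where F: "computable (\<lambda>z. F (fst z) (snd z))"
    "\<And>x p i. x \<in> X \<Longrightarrow> rho_rep p x \<Longrightarrow> \<exists>n v. F i (pre p n) = Suc v"
    "\<And>x p i n v. x \<in> X \<Longrightarrow> rho_rep p x \<Longrightarrow> F i (pre p n) = Suc v \<Longrightarrow> dist (vec_dec v) (f x) < inverse (2 ^ i)"
    using rho_rep_computableE[OF f] by blast
  obtain M where M: "computable M"
    "\<And>a p. a \<in> X \<times> UNIV \<Longrightarrow> pair_rep rho_rep nu_rep p a \<Longrightarrow> \<exists>n l. M (pre p n) = Suc l"
    "\<And>a p n l. a \<in> X \<times> UNIV \<Longrightarrow> pair_rep rho_rep nu_rep p a \<Longrightarrow> M (pre p n) = Suc l \<Longrightarrow>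
      l \<in> (case a of (x, k) \<Rightarrow> moo x k)"
    using nu_rep_computableE[OF moo(1)] by blast
  \<comment> \<open>Openness itself asks only for some value of the modulus at each point; running
    its machine on any name provides one.\<close>
  have open_image: "open (f ` U)" if U: "open U" "U \<subseteq> X" for U
  proof (rule openI)
    fix y assume "y \<in> f ` U"
    then obtain z where z: "z \<in> U" "y = f z" by blast
    obtain e where e: "e > 0" "ball z e \<subseteq> U" using U(1) z(1) by (meson openE)
    obtain k where k: "inverse (2 ^ k) < e" using ex_inverse_power2_less[OF e(1)] by blast
    obtain p where "rho_rep p z" by (rule rho_rep_ex)
    then have "pair_rep rho_rep nu_rep (pair_const p k) (z, k)" by (rule pair_rep_pair_const)
    then obtain l where "l \<in> moo z k"
      using mv_computable_nonempty[OF moo(1), of "(z, k)" "pair_const p k"] z(1) U(2) by auto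
    then have "ball y (inverse (2 ^ l)) \<subseteq> f ` (ball z (inverse (2 ^ k)) \<inter> X)"
      using moo(2) z U(2) by blast
    also have "\<dots> \<subseteq> f ` U" using e(2) k by (intro image_mono) (auto simp: subset_iff)
    finally show "\<exists>e>0. ball y e \<subseteq> f ` U" by (intro exI[of _ "inverse (2 ^ l)"]) simp
  qed
  define l where "l u c k n = M (pre (pair_const (eventually_const u c) k) n) - 1" for u c k n
  \<comment> \<open>\<open>u\<close> starts a name of the rational point \<open>vec_dec c\<close>,
    the ball of radius 2^-k about this point fits into the listed ball \<open>s\<close>, and
    \<open>M\<close> and \<open>F\<close> answer on the name after \<open>n\<close> and
    \<open>n'\<close> symbols.\<close>
  define C where "C u c k n n' s \<longleftrightarrow> s \<noteq> 0 \<and>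
    (\<forall>m<length u. dist (vec_dec (nth0 u m) :: real ^ 'n) (vec_dec c) < inverse (2 ^ m)) \<and>
    dist (vec_dec (fst (prod_decode (s - 1))) :: real ^ 'n) (vec_dec c)
      < rat_dec (snd (prod_decode (s - 1))) - inverse (2 ^ k) \<and>
    M (pre (pair_const (eventually_const u c) k) n) \<noteq> 0 \<and>
    F (l u c k n + 3) (pre (eventually_const u c) n') \<noteq> 0" for u c k n n' s
  \<comment> \<open>Half the radius 2^-l and an eighth of it as error in the centre:
    \<open>1/2 + 1/8 < 1\<close> keeps the ball inside the image, while
    \<open>1/8 + 1/8 < 1/2\<close> lets it reach \<open>f z\<close> if \<open>f z\<close> is within
    an eighth of the value at the rational point. If the test fails, the symbol 0 contributes the
    empty set.\<close>
  define S where "S u c k n n' s = (if C u c k n n' s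
    then Suc (prod_encode (F (l u c k n + 3) (pre (eventually_const u c) n') - 1,
      inv_pow_code (l u c k n + 1))) else 0)" for u c k n n' s
  have sound: "theta_ball (S u c k n n' s) \<subseteq> f ` U"
    if s: "theta_ball s \<subseteq> U" "U \<subseteq> X" for u c k n n' s and U :: "(real ^ 'n) set"
  proof (cases "C u c k n n' s")
    case True
    define x where "x = (vec_dec c :: real ^ 'n)"
    have "rho_rep (eventually_const u c) x"
      unfolding x_def using True by (intro rho_rep_eventually_const) (auto simp: C_def)
    note nm = this pair_rep_pair_const[OF this, of k]
    have sub: "ball x (inverse (2 ^ k)) \<subseteq> theta_ball s"
    proof
      fix y assume "y \<in> ball x (inverse (2 ^ k))"
      then show "y \<in> theta_ball s"
        using True dist_triangle[of "vec_dec (fst (prod_decode (s - 1)))" y x]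
        by (simp add: C_def theta_ball_def x_def)
    qed
    then have x: "x \<in> X" using s by force
    have "M (pre (pair_const (eventually_const u c) k) n) = Suc (l u c k n)"
      using True by (simp add: C_def l_def)
    from M(3)[OF _ nm(2) this] x have l: "l u c k n \<in> moo x k" by simp
    define v where "v = F (l u c k n + 3) (pre (eventually_const u c) n') - 1"
    have "F (l u c k n + 3) (pre (eventually_const u c) n') = Suc v"
      using True by (simp add: C_def v_def)
    from F(3)[OF x nm(1) this] have v: "dist (vec_dec v) (f x) < inverse (2 ^ (l u c k n + 3))" .
    have "theta_ball (S u c k n n' s) = ball (vec_dec v :: real ^ 'm) (inverse (2 ^ (l u c k n + 1)))"
      using True by (simp add: S_def v_def)
    also have "\<dots> \<subseteq> ball (f x) (inverse (2 ^ l u c k n))"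
    proof
      fix y assume "y \<in> ball (vec_dec v :: real ^ 'm) (inverse (2 ^ (l u c k n + 1)))"
      moreover have "inverse (2 ^ (l u c k n + 3)) = inverse (2 ^ l u c k n) / (8 :: real)"
        "inverse (2 ^ (l u c k n + 1)) = inverse (2 ^ l u c k n) / (2 :: real)"
        by (simp_all add: power_add)
      ultimately show "y \<in> ball (f x) (inverse (2 ^ l u c k n))"
        using v dist_triangle3[of "f x" y "vec_dec v"] zero_le_dist[of "vec_dec v" "f x"]
        unfolding mem_ball by linarith
    qed
    also have "\<dots> \<subseteq> f ` (ball x (inverse (2 ^ k)) \<inter> X)" using moo(2)[OF x l] .
    also have "\<dots> \<subseteq> f ` U" using sub s by auto
    finally show ?thesis .
  qed (simp add: S_def theta_ball_def)
  have complete: "\<exists>u c k n n'. f z \<in> theta_ball (S u c k n n' s)"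
    if z: "z \<in> theta_ball s" "theta_ball s \<subseteq> X" for z s
  proof -
    define cc where "cc = (vec_dec (fst (prod_decode (s - 1))) :: real ^ 'n)"
    define rr where "rr = rat_dec (snd (prod_decode (s - 1)))"
    have s0: "s \<noteq> 0" using z(1) by (auto simp: theta_ball_def split: if_splits)
    have ball_s: "theta_ball s = ball cc rr" using s0 by (simp add: theta_ball_def cc_def rr_def)
    then have "0 < rr - dist cc z" using z(1) by simp
    then obtain k where k: "inverse (2 ^ k) < (rr - dist cc z) / 2"
      using ex_inverse_power2_less[of "(rr - dist cc z) / 2"] by auto
    have zX: "z \<in> X" using z by blast
    obtain p where p: "rho_rep p z" by (rule rho_rep_ex)
    obtain n l0 where l0: "M (pre (pair_const p k) n) = Suc l0"
      using M(2)[OF _ pair_rep_pair_const[OF p, of k]] zX by auto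
    \<comment> \<open>\<open>l0\<close> is fixed before the rational point is chosen, so the
      closeness required here may depend on it without circularity.\<close>
    obtain d1 where d1: "d1 > 0" "\<And>y. y \<in> X \<Longrightarrow> dist z y < d1 \<Longrightarrow> dist (f z) (f y) < inverse (2 ^ (l0 + 3))"
      using computable_imp_continuous[OF f zX, of "inverse (2 ^ (l0 + 3))"] by auto
    obtain d2 where d2: "d2 > 0" "\<And>i. i < n \<Longrightarrow> dist (vec_dec (p i)) z + d2 \<le> inverse (2 ^ i)"
      using ex_uniform_gap[of n "\<lambda>i. dist (vec_dec (p i)) z" "\<lambda>i. inverse (2 ^ i)"] p
      unfolding rho_rep_def by blast
    \<comment> \<open>\<open>d1\<close> controls \<open>f\<close>, \<open>d2\<close> lets the prefix
      of \<open>p\<close> start a name of the rational point as well, and the last term keeps its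
      ball of radius 2^-k inside the listed ball.\<close>
    define d where "d = min (min d1 d2) ((rr - dist cc z) / 2)"
    have "d > 0" using d1 d2 \<open>0 < rr - dist cc z\<close> by (simp add: d_def)
    then obtain c where c: "dist (vec_dec c) z < d" using ex_vec_dec_near by blast
    define x where "x = (vec_dec c :: real ^ 'n)"
    have xd: "dist x z < d1" "dist x z < d2" "dist x z < (rr - dist cc z) / 2"
      using c by (simp_all add: x_def d_def)
    define u where "u = pre p n"
    have u: "dist (vec_dec (nth0 u m) :: real ^ 'n) x < inverse (2 ^ m)" if "m < length u" for m
      using that d2(2)[of m] xd(2) dist_triangle2[of "vec_dec (p m)" x z] by (simp add: u_def)
    have cx: "dist cc x < rr - inverse (2 ^ k)"
      using xd(3) k dist_triangle2[of cc x z] by argo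
    have "0 < inverse (2 ^ k :: real)" by simp
    with cx have "dist cc x < rr" by linarith
    then have "x \<in> theta_ball s" using ball_s by simp
    then have xX: "x \<in> X" using z(2) by blast
    have "pre (pair_const (eventually_const u c) k) n = pre (pair_const p k) n"
      by (rule pre_pair_const_cong) (simp add: eventually_const_def u_def)
    then have Mu: "M (pre (pair_const (eventually_const u c) k) n) = Suc l0" using l0 by simp
    then have lu: "l u c k n = l0" by (simp add: l_def)
    have nm: "rho_rep (eventually_const u c) x"
      unfolding x_def using u unfolding x_def by (rule rho_rep_eventually_const)
    obtain n' v where v: "F (l0 + 3) (pre (eventually_const u c) n') = Suc v"
      using F(2)[OF xX nm] by blast
    have "C u c k n n' s"
      using s0 u cx Mu v by (simp add: C_def lu x_def cc_def rr_def)
    then have "theta_ball (S u c k n n' s) = ball (vec_dec v :: real ^ 'm) (inverse (2 ^ (l0 + 1)))"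
      by (simp add: S_def lu v)
    moreover have "dist (vec_dec v) (f z) < inverse (2 ^ (l0 + 1))"
    proof -
      have "dist (vec_dec v) (f x) < inverse (2 ^ (l0 + 3))" using F(3)[OF xX nm v] .
      moreover have "dist (f z) (f x) < inverse (2 ^ (l0 + 3))" using d1(2)[OF xX] xd(1) by (simp add: dist_commute)
      moreover have "inverse (2 ^ (l0 + 3)) + inverse (2 ^ (l0 + 3)) \<le> inverse (2 ^ (l0 + 1) :: real)"
        by (simp add: power_add)
      ultimately show ?thesis using dist_triangle2[of "vec_dec v" "f z" "f x"] by linarith
    qed
    ultimately show ?thesis by (metis mem_ball)
  qed
  \<comment> \<open>The output index \<open>i\<close> carries the enumeration: it decodes to the
    data of \<open>S\<close> and a position in the input list, so the machine only waits for that
    input symbol.\<close>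
  define G :: "nat \<Rightarrow> nat list \<Rightarrow> nat list \<Rightarrow> nat" where "G i t w =
    (if nth0 (list_decode i) 5 < length w
     then Suc (S (list_decode (nth0 (list_decode i) 0)) (nth0 (list_decode i) 1) (nth0 (list_decode i) 2)
       (nth0 (list_decode i) 3) (nth0 (list_decode i) 4) (nth0 w (nth0 (list_decode i) 5)))
     else 0)" for i t w
  have "mv_computable theta_rep theta_rep {U. open U \<and> U \<subseteq> X} (\<lambda>U. {f ` U})"
  proof (rule mv_computableI)
    show "computable (\<lambda>z. G (fst z) (fst (snd z)) (snd (snd z)))"
      unfolding G_def S_def C_def l_def eventually_const_def
      by (intro computable_intros computable_comp[OF M(1)] computable_comp2[OF F(1)])
  next
    show "\<exists>t n. G i t (pre p n) \<noteq> 0" for p i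
      by (rule exI, rule exI[of _ "Suc (nth0 (list_decode i) 5)"]) (simp add: G_def)
  next
    fix U p q assume U: "U \<in> {U. open U \<and> U \<subseteq> X}" "theta_rep p U"
      and q: "\<And>i. \<exists>t n. G i t (pre p n) = Suc (q i)"
    have q_eq: "q i = S (list_decode (nth0 (list_decode i) 0)) (nth0 (list_decode i) 1)
      (nth0 (list_decode i) 2) (nth0 (list_decode i) 3) (nth0 (list_decode i) 4)
      (p (nth0 (list_decode i) 5))" for i
      using q[of i] by (auto simp: G_def split: if_splits)
    have p: "theta_ball (p k) \<subseteq> U" for k using U(2) by (auto simp: theta_rep_iff)
    have "f ` U = (\<Union>i. theta_ball (q i))"
    proof (intro equalityI subsetI)
      fix y assume "y \<in> f ` U"
      then obtain z j where z: "y = f z" "z \<in> theta_ball (p j)" using U(2) by (auto simp: theta_rep_iff)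
      then obtain u c k n n' where "y \<in> theta_ball (S u c k n n' (p j))"
        using complete[of z "p j"] p U(1) by blast
      then have "y \<in> theta_ball (q (list_encode [list_encode u, c, k, n, n', j]))"
        by (simp add: q_eq nth0_def)
      then show "y \<in> (\<Union>i. theta_ball (q i))" by blast
    next
      fix y :: "real ^ 'm" assume "y \<in> (\<Union>i. theta_ball (q i))"
      then show "y \<in> f ` U" using sound[OF p] U(1) unfolding q_eq by blast
    qed
    then show "\<exists>b\<in>{f ` U}. theta_rep q b" by (simp add: theta_rep_iff)
  qed
  then show ?thesis using open_image by (simp add: eff_open_def fn_computable_def)
qed

section \<open>From effective openness to lower approximations of \<open>Moo\<close>\<close>

text \<open>The list consists of the rational balls that fit, with a margin a machine can verify,
  into a listed ball of \<open>X\<close> and into the ball about \<open>x\<close>; the index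
  \<open>s\<close> codes centre, radius, precision for \<open>x\<close> and position in the list of
  \<open>X\<close>. The second clause is locality: it lets another machine be run on
  \<open>N p\<close> when only a prefix of \<open>p\<close> is known.\<close>

lemma theta_rep_ball_Int:
  fixes X :: "(real ^ 'n::finite) set"
  assumes "comp_elem theta_rep X"
  obtains N where "computable (\<lambda>z. N (nth0 (fst z)) (snd z))"
    "\<And>p p' s. p 1 = p' 1 \<Longrightarrow> p (2 * nth0 (list_decode s) 2) = p' (2 * nth0 (list_decode s) 2) \<Longrightarrow>
      N p s = N p' s"
    "\<And>p x k. pair_rep rho_rep nu_rep p (x, k) \<Longrightarrow> theta_rep (N p) (ball x (inverse (2 ^ k)) \<inter> X)"
proof -
  obtain Y where Y: "rec_computable Y" "theta_rep Y X"
    using assms unfolding comp_elem_def by blast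
  have X: "X = (\<Union>k. theta_ball (Y k))" using Y(2) by (simp add: theta_rep_iff)
  define C where "C p c r i j \<longleftrightarrow> Y j \<noteq> 0 \<and>
    dist (vec_dec (fst (prod_decode (Y j - 1))) :: real ^ 'n) (vec_dec c)
      < rat_dec (snd (prod_decode (Y j - 1))) - rat_dec r \<and>
    dist (vec_dec (p (2 * i)) :: real ^ 'n) (vec_dec c)
      < inverse (2 ^ p 1) - inverse (2 ^ i) - rat_dec r" for p :: name and c r i j
  define N where "N p s = (if C p (nth0 (list_decode s) 0) (nth0 (list_decode s) 1)
      (nth0 (list_decode s) 2) (nth0 (list_decode s) 3)
    then Suc (prod_encode (nth0 (list_decode s) 0, nth0 (list_decode s) 1)) else 0)" for p s
  show thesis
  proof
    show "computable (\<lambda>z. N (nth0 (fst z)) (snd z))"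
      unfolding N_def C_def by (intro computable_intros computable_rec_computable[OF Y(1)])
    show "N p s = N p' s" if "p 1 = p' 1" "p (2 * nth0 (list_decode s) 2) = p' (2 * nth0 (list_decode s) 2)"
      for p p' s
      unfolding N_def C_def that ..
    fix p k and x :: "real ^ 'n" assume p: "pair_rep rho_rep nu_rep p (x, k)"
    have pk: "p 1 = k" and px: "\<And>i. dist (vec_dec (p (2 * i))) x < inverse (2 ^ i)"
      using pair_rep_nuD[OF p] pair_rep_fstD[OF p] by (simp_all add: rho_rep_def)
    have "ball x (inverse (2 ^ k)) \<inter> X = (\<Union>s. theta_ball (N p s))"
    proof (intro equalityI subsetI)
      fix y assume "y \<in> ball x (inverse (2 ^ k)) \<inter> X"
      then obtain j where y: "dist x y < inverse (2 ^ k)" "y \<in> theta_ball (Y j)" by (auto simp: X)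
      define cc where "cc = (vec_dec (fst (prod_decode (Y j - 1))) :: real ^ 'n)"
      define rr where "rr = rat_dec (snd (prod_decode (Y j - 1)))"
      have Yj: "Y j \<noteq> 0" "dist cc y < rr"
        using y(2) by (auto simp: theta_ball_def cc_def rr_def split: if_splits)
      define d where "d = min (inverse (2 ^ k) - dist x y) (rr - dist cc y)"
      have "d > 0" using y(1) Yj by (simp add: d_def)
      \<comment> \<open>Four times 2^-a is spent: on the distance of the new centre from
        \<open>y\<close>, the error in \<open>x\<close>, the margin of the test and the new
        radius.\<close>
      then obtain a where a: "inverse (2 ^ a) < d / 4" using ex_inverse_power2_less[of "d / 4"] by auto
      obtain c where c: "dist (vec_dec c) y < inverse (2 ^ a)" using ex_vec_dec_near[of "inverse (2 ^ a)" y] by auto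
      have d: "d \<le> inverse (2 ^ k) - dist x y" "d \<le> rr - dist cc y" by (simp_all add: d_def)
      have "dist cc (vec_dec c) < rr - inverse (2 ^ a)"
        using dist_triangle2[of cc "vec_dec c" y] c a d(2) \<open>d > 0\<close> by linarith
      moreover have "dist (vec_dec (p (2 * a)) :: real ^ 'n) (vec_dec c) < inverse (2 ^ p 1) - inverse (2 ^ a) - inverse (2 ^ a)"
        using dist_triangle[of "vec_dec (p (2 * a))" "vec_dec c" x] dist_triangle2[of x "vec_dec c" y]
          px[of a] c a d(1) \<open>d > 0\<close> unfolding pk by linarith
      ultimately have "C p c (inv_pow_code a) a j"
        using Yj(1) by (simp add: C_def cc_def rr_def)
      then have "theta_ball (N p (list_encode [c, inv_pow_code a, a, j]))
          = ball (vec_dec c :: real ^ 'n) (inverse (2 ^ a))"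
        by (simp add: N_def nth0_def)
      then have "y \<in> theta_ball (N p (list_encode [c, inv_pow_code a, a, j]))"
        using c by simp
      then show "y \<in> (\<Union>s. theta_ball (N p s))" by blast
    next
      fix y :: "real ^ 'n" assume "y \<in> (\<Union>s. theta_ball (N p s))"
      then obtain s where s: "y \<in> theta_ball (N p s)" by blast
      define c r i j where "c = nth0 (list_decode s) 0" and "r = nth0 (list_decode s) 1"
        and "i = nth0 (list_decode s) 2" and "j = nth0 (list_decode s) 3"
      have C: "C p c r i j" and y: "dist (vec_dec c) y < rat_dec r"
        using s by (auto simp: N_def c_def r_def i_def j_def theta_ball_def split: if_splits)
      have "dist x y < inverse (2 ^ k)"
        using C y px[of i] dist_triangle3[of x y "vec_dec (p (2 * i))"]
          dist_triangle[of "vec_dec (p (2 * i))" y "vec_dec c"] unfolding C_def pk by linarith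
      moreover have "y \<in> theta_ball (Y j)"
        using C y dist_triangle[of "vec_dec (fst (prod_decode (Y j - 1)))" y "vec_dec c"]
        by (simp add: C_def theta_ball_def)
      ultimately show "y \<in> ball x (inverse (2 ^ k)) \<inter> X" by (auto simp: X)
    qed
    then show "theta_rep (N p) (ball x (inverse (2 ^ k)) \<inter> X)" by (simp add: theta_rep_iff)
  qed
qed

text \<open>The excess \<open>e\<close> yields the strict inequality that lower names require.
  Candidates \<open>s\<close> range over all rationals; if even \<open>s + e\<close> is negative,
  the closed ball is empty and positivity of \<open>Moo\<close> decides.\<close>

lemma less_MooI:
  assumes "cball (f x) (s + e) \<subseteq> f ` (ball x (inverse (2 ^ k)) \<inter> X)" "0 < e" "0 < Moo X f x k"
  shows "ereal s < Moo X f x k"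
proof (cases "0 \<le> s + e")
  case True
  then have "ereal (s + e) \<le> Moo X f x k"
    unfolding Moo_def using assms(1) by (intro Sup_upper) blast
  moreover have "ereal s < ereal (s + e)" using assms(2) by simp
  ultimately show ?thesis by (rule less_le_trans[rotated])
next
  case False
  then have "ereal s < 0" using assms(2) by (simp add: zero_ereal_def)
  then show ?thesis using assms(3) by (rule less_trans)
qed

lemma eff_open_imp_Moo_pos:
  assumes "eff_open X f" "open X" "x \<in> X"
  shows "0 < Moo X f x k"
proof -
  have "open (f ` (ball x (inverse (2 ^ k)) \<inter> X))"
    using assms(1,2) open_Int[OF open_ball assms(2)] unfolding eff_open_def by blast
  moreover have "f x \<in> f ` (ball x (inverse (2 ^ k)) \<inter> X)" using assms(3) by auto
  ultimately obtain e where e: "e > 0" "cball (f x) e \<subseteq> f ` (ball x (inverse (2 ^ k)) \<inter> X)"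
    by (meson open_contains_cball)
  then have "ereal e \<le> Moo X f x k"
    unfolding Moo_def by (intro Sup_upper) force
  then show ?thesis using e(1) by (meson ereal_less(2) less_le_trans)
qed

text \<open>Inclusion of a closed ball in a union of balls is certified on a finite grid: every
  grid point near the closed ball lies in one of finitely many balls with a margin exceeding the mesh.
  Compactness, in the form of a Lebesgue number, shows that such a certificate exists.\<close>

lemma grid_cover_sound:
  fixes y v :: "'a::real_normed_vector"
  assumes grid: "\<And>z. norm z \<le> K \<Longrightarrow> \<exists>c\<in>D. dist c z < e"
    and v: "dist v y < e" "norm v < K - s - 2" "e \<le> 1"
    and cov: "\<And>c. c \<in> D \<Longrightarrow> dist c v < s + 4 * e \<Longrightarrow> \<exists>b r. ball b r \<subseteq> V \<and> dist b c < r - e"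
  shows "cball y (s + e) \<subseteq> V"
proof
  fix z assume "z \<in> cball y (s + e)"
  then have z: "dist y z \<le> s + e" by simp
  have "norm z \<le> norm v + dist v z" using norm_triangle_sub[of z v] by (simp add: dist_norm norm_minus_commute)
  \<comment> \<open>\<open>dist v z < s + 2 * e \<le> s + 2\<close>, which explains the 2 in the
    bound on \<open>norm v\<close>.\<close>
  then have "norm z \<le> K" using dist_triangle[of v z y] v z by linarith
  then obtain c where c: "c \<in> D" "dist c z < e" using grid by blast
  have "0 < e" using v(1) zero_le_dist[of v y] by linarith
  \<comment> \<open>The triangle inequality gives \<open>s + 3 * e\<close>: one \<open>e\<close>
    each for the mesh, the error in \<open>v\<close> and the excess radius.\<close>
  then have "dist c v < s + 4 * e"
    using dist_triangle[of c v z] dist_triangle[of v z y] c(2) v(1) z by (simp add: dist_commute)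
  then obtain b r where b: "ball b r \<subseteq> V" "dist b c < r - e" using cov[OF c(1)] by blast
  then have "dist b z < r" using dist_triangle[of b z c] c(2) by linarith
  then show "z \<in> V" using b(1) by auto
qed

text \<open>Merges the waiting times of finitely many grid points into one.\<close>

lemma ex_uniform_bound:
  fixes P :: "nat \<Rightarrow> nat \<Rightarrow> bool"
  assumes "\<And>c. c < n \<Longrightarrow> \<exists>m. P c m" "\<And>c m m'. P c m \<Longrightarrow> m \<le> m' \<Longrightarrow> P c m'"
  shows "\<exists>m. \<forall>c<n. P c m"
  using assms(1)
proof (induction n)
  case (Suc n)
  then obtain m m' where "\<forall>c<n. P c m" "P n m'" by (metis less_Suc_eq)
  then have "\<forall>c<Suc n. P c (max m m')"
    using assms(2) by (metis less_Suc_eq max.cobounded1 max.cobounded2)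
  then show ?case ..
qed simp

lemma ex_rat_dec_between:
  assumes "s < t" shows "\<exists>c. s < rat_dec c \<and> rat_dec c < t"
proof -
  obtain a where a: "inverse (2 ^ a) < (t - s) / 2"
    using ex_inverse_power2_less[of "(t - s) / 2"] assms by auto
  obtain K where "\<bar>(s + t) / 2\<bar> \<le> real K" using real_arch_simple by blast
  from ex_rat_dec_grid[OF this, of a] obtain c where "\<bar>rat_dec c - (s + t) / 2\<bar> \<le> inverse (2 ^ a)" by blast
  with a have "\<bar>rat_dec c - (s + t) / 2\<bar> < (t - s) / 2" by linarith
  then show ?thesis by (intro exI[of _ c]) (auto simp: abs_less_iff field_simps)
qed

text \<open>A ball of Lebesgue radius \<open>e\<close> about \<open>c\<close> lies in a single ball
  of the cover. In Euclidean space this is an inequality between centres and radii, which can be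
  tested on approximations.\<close>

lemma Lebesgue_margin:
  fixes y :: "'a::euclidean_space" and b :: "nat \<Rightarrow> 'a"
  assumes "cball y s \<subseteq> (\<Union>j. ball (b j) (r j))"
  obtains e where "0 < e" "\<And>c. dist y c \<le> s \<Longrightarrow> \<exists>j. dist (b j) c + e \<le> r j"
proof -
  obtain e where e: "0 < e" "\<And>c. c \<in> cball y s \<Longrightarrow> \<exists>B\<in>range (\<lambda>j. ball (b j) (r j)). ball c e \<subseteq> B"
    using Heine_Borel_lemma[OF compact_cball, of y s "range (\<lambda>j. ball (b j) (r j))"] assms by blast
  have "\<exists>j. dist (b j) c + e \<le> r j" if "dist y c \<le> s" for c
  proof -
    obtain j where "ball c e \<subseteq> ball (b j) (r j)" using e(2)[of c] \<open>dist y c \<le> s\<close> by auto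
    then have "dist c (b j) + e \<le> r j" using e(1) by (simp add: ball_subset_ball_iff)
    then show ?thesis by (auto simp: dist_commute)
  qed
  then show thesis using that e(1) by blast
qed

text \<open>The machine for images runs on the name \<open>N p\<close> of
  \<open>B(x, 2^-k) \<inter> X\<close>, itself produced from \<open>p\<close> on demand. A rational
  \<open>sc\<close> is listed once finitely many of the resulting balls are seen to cover the closed
  ball of radius \<open>sc + 2^-a\<close> about \<open>f x\<close>.\<close>

lemma computable_Moo_of_eff_open:
  fixes f :: "real ^ 'n::finite \<Rightarrow> real ^ 'm::finite"
  assumes X: "comp_elem theta_rep X" "open X"
    and f: "fn_computable rho_rep rho_rep X f" and eff: "eff_open X f"
  shows "fn_computable (pair_rep rho_rep nu_rep) rhol_rep (X \<times> UNIV) (\<lambda>(x, k). Moo X f x k)"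
proof -
  obtain F where F: "computable (\<lambda>z. F (fst z) (snd z))"
    "\<And>x p i. x \<in> X \<Longrightarrow> rho_rep p x \<Longrightarrow> \<exists>n v. F i (pre p n) = Suc v"
    "\<And>x p i n v. x \<in> X \<Longrightarrow> rho_rep p x \<Longrightarrow> F i (pre p n) = Suc v \<Longrightarrow> dist (vec_dec v) (f x) < inverse (2 ^ i)"
    using rho_rep_computableE[OF f] by blast
  obtain N where N: "computable (\<lambda>z. N (nth0 (fst z)) (snd z))"
    "\<And>p p' s. p 1 = p' 1 \<Longrightarrow> p (2 * nth0 (list_decode s) 2) = p' (2 * nth0 (list_decode s) 2) \<Longrightarrow>
      N p s = N p' s"
    "\<And>p x k. pair_rep rho_rep nu_rep p (x, k) \<Longrightarrow> theta_rep (N p) (ball x (inverse (2 ^ k)) \<inter> X)"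
    using theta_rep_ball_Int[OF X(1)] by blast
  have "mv_computable theta_rep theta_rep {U. open U \<and> U \<subseteq> X} (\<lambda>U. {f ` U})"
    using eff unfolding eff_open_def fn_computable_def by blast
  then obtain E where E: "computable (\<lambda>z. E (fst z) (snd z))"
    "\<And>U p. U \<in> {U. open U \<and> U \<subseteq> X} \<Longrightarrow> theta_rep p U \<Longrightarrow> \<exists>q. \<exists>b\<in>{f ` U}. theta_rep q b \<and>
      (\<forall>i. (\<exists>n. E i (pre p n) = Suc (q i)) \<and> (\<forall>n v. E i (pre p n) = Suc v \<longrightarrow> v = q i))"
    using mv_computableE by blast
  have E_run: "\<exists>q. theta_rep q (f ` (ball x (inverse (2 ^ k)) \<inter> X)) \<and>
      (\<forall>i. (\<exists>n. E i (pre (N p) n) = Suc (q i)) \<and> (\<forall>n v. E i (pre (N p) n) = Suc v \<longrightarrow> v = q i))"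
    if "pair_rep rho_rep nu_rep p (x, k)" for p x k
    using E(2)[OF _ N(3)[OF that]] X(2) by blast
  obtain L where L: "\<And>(x :: real ^ 'm) K a. norm x \<le> real K \<Longrightarrow>
     \<exists>c \<le> grid_bound L (a + CARD('m)) K. dist (vec_dec c) x < inverse (2 ^ a)"
    using ex_vec_dec_grid[where 'n = 'm] by blast
  \<comment> \<open>\<open>E\<close> answers with \<open>Suc (q j)\<close>, and a nonzero
    \<open>q j\<close> is in turn one more than the code of a ball; hence \<open>1 <\<close> and
    \<open>- 2\<close>.\<close>
  define inside where "inside p a m c \<longleftrightarrow> (\<exists>j<m. \<exists>m'<m. 1 < E j (pre (N p) m') \<and>
      dist (vec_dec (fst (prod_decode (E j (pre (N p) m') - 2))) :: real ^ 'm) (vec_dec c)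
        < rat_dec (snd (prod_decode (E j (pre (N p) m') - 2))) - inverse (2 ^ a))" for p a m c
  define fx where "fx p a n' = F a (pre (\<lambda>i. p (2 * i)) n')" for p :: name and a n'
  \<comment> \<open>\<open>vec_dec 0\<close> is the origin, so the second condition bounds a norm
    and makes the grid for \<open>K\<close> reach every point to be covered. All codes up to the
    bound are tested, also those off the grid; only vectors near the approximation of
    \<open>f x\<close> have to be inside.\<close>
  define C where "C p sc a m K n' \<longleftrightarrow> fx p a n' \<noteq> 0 \<and>
      dist (vec_dec (fx p a n' - 1) :: real ^ 'm) (vec_dec 0) < real K - rat_dec sc - 2 \<and>
      (\<forall>c<Suc (grid_bound L (a + CARD('m)) K).
        dist (vec_dec c :: real ^ 'm) (vec_dec (fx p a n' - 1)) < rat_dec sc + 4 * inverse (2 ^ a)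
        \<longrightarrow> inside p a m c)" for p sc a m K n'
  \<comment> \<open>Ensures that \<open>n\<close> symbols determine the outcome of \<open>C\<close>:
    position 1 holds \<open>k\<close>, \<open>F\<close> reads even positions below
    \<open>2 * n'\<close>, and symbol \<open>s\<close> of \<open>N p\<close> depends on position 1
    and one even position.\<close>
  define guard where "guard m n' n \<longleftrightarrow> 1 < n \<and> 2 * n' < n \<and> (\<forall>s<m. 2 * nth0 (list_decode s) 2 < n)"
    for m n' n
  \<comment> \<open>A failed test still produces a symbol: the code 0 of the rational 0, a correct
    strict lower bound because \<open>Moo\<close> is positive.\<close>
  define G :: "nat \<Rightarrow> nat list \<Rightarrow> nat list \<Rightarrow> nat" where "G i t w =
    (let d = nth0 (list_decode i) in if d 5 \<le> length w
     then if guard (d 2) (d 4) (d 5) \<and> C (nth0 w) (d 0) (d 1) (d 2) (d 3) (d 4) then Suc (d 0) else Suc 0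
     else 0)" for i t w
  have C_local: "C (nth0 (pre p n0)) sc a m K n' \<longleftrightarrow> C p sc a m K n'"
    if "guard m n' n" "n \<le> n0" for p n0 sc a m K n n'
  proof -
    have "fx (nth0 (pre p n0)) a n' = fx p a n'"
    proof -
      have "pre (\<lambda>i. nth0 (pre p n0) (2 * i)) n' = pre (\<lambda>i. p (2 * i)) n'"
        using that by (intro pre_cong) (simp add: guard_def)
      then show ?thesis by (simp add: fx_def)
    qed
    moreover have "inside (nth0 (pre p n0)) a m c \<longleftrightarrow> inside p a m c" for c
    proof -
      have "pre (N (nth0 (pre p n0))) m' = pre (N p) m'" if "m' < m" for m'
      proof (intro pre_cong N(2))
        fix i assume "i < m'"
        then have "2 * nth0 (list_decode i) 2 < n0" "1 < n0"
          using \<open>m' < m\<close> \<open>guard m n' n\<close> \<open>n \<le> n0\<close> unfolding guard_def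
          by (meson less_le_trans less_trans)+
        then show "nth0 (pre p n0) 1 = p 1"
          "nth0 (pre p n0) (2 * nth0 (list_decode i) 2) = p (2 * nth0 (list_decode i) 2)"
          by simp_all
      qed
      then show ?thesis by (simp add: inside_def cong: conj_cong)
    qed
    ultimately show ?thesis by (simp add: C_def)
  qed
  have sound: "ereal (rat_dec sc) < Moo X f x k"
    if p: "pair_rep rho_rep nu_rep p (x, k)" "x \<in> X" and C: "C p sc a m K n'" for p x k sc a m K n'
  proof -
    obtain q where q: "theta_rep q (f ` (ball x (inverse (2 ^ k)) \<inter> X))"
      "\<And>i n v. E i (pre (N p) n) = Suc v \<Longrightarrow> v = q i" using E_run[OF p(1)] by blast
    define v where "v = (vec_dec (fx p a n' - 1) :: real ^ 'm)"
    have "cball (f x) (rat_dec sc + inverse (2 ^ a)) \<subseteq> f ` (ball x (inverse (2 ^ k)) \<inter> X)"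
    proof (rule grid_cover_sound)
      show "\<exists>c\<in>vec_dec ` {..grid_bound L (a + CARD('m)) K}. dist c z < inverse (2 ^ a)"
        if "norm z \<le> real K" for z :: "real ^ 'm"
        using L[OF that, of a] by auto
      have "fx p a n' = Suc (fx p a n' - 1)" using C by (simp add: C_def)
      then show "dist v (f x) < inverse (2 ^ a)"
        using F(3)[OF p(2) pair_rep_fstD[OF p(1)]] unfolding fx_def v_def by blast
      show "norm v < real K - rat_dec sc - 2" using C by (simp add: C_def v_def)
      show "inverse (2 ^ a) \<le> (1 :: real)" by (simp add: inverse_le_1_iff)
      fix c assume "c \<in> (vec_dec ` {..grid_bound L (a + CARD('m)) K} :: (real ^ 'm) set)"
        and near: "dist c v < rat_dec sc + 4 * inverse (2 ^ a)"
      then obtain c' where c': "c = vec_dec c'" "c' < Suc (grid_bound L (a + CARD('m)) K)" by auto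
      then have "inside p a m c'" using C near by (simp add: C_def v_def)
      then obtain j m' where j: "1 < E j (pre (N p) m')"
        "dist (vec_dec (fst (prod_decode (E j (pre (N p) m') - 2))) :: real ^ 'm) c
          < rat_dec (snd (prod_decode (E j (pre (N p) m') - 2))) - inverse (2 ^ a)"
        unfolding inside_def c'(1) by blast
      have qj: "E j (pre (N p) m') - 1 = q j" using q(2)[of j m' "E j (pre (N p) m') - 1"] j(1) by simp
      have "theta_ball (q j) \<subseteq> f ` (ball x (inverse (2 ^ k)) \<inter> X)" using q(1) by (auto simp: theta_rep_iff)
      moreover have "E j (pre (N p) m') - 2 = q j - 1" "q j \<noteq> 0" using qj j(1) by auto
      ultimately show "\<exists>b r. ball b r \<subseteq> f ` (ball x (inverse (2 ^ k)) \<inter> X) \<and> dist b c < r - inverse (2 ^ a)"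
        using j(2) by (auto simp: theta_ball_def)
    qed
    then show ?thesis by (rule less_MooI) (use eff_open_imp_Moo_pos[OF eff X(2) p(2)] in auto)
  qed
  have complete: "\<exists>sc a m K n'. C p sc a m K n' \<and> z < ereal (rat_dec sc)"
    if p: "pair_rep rho_rep nu_rep p (x, k)" "x \<in> X" and z: "z < Moo X f x k" for p x k z
  proof -
    obtain q where q: "theta_rep q (f ` (ball x (inverse (2 ^ k)) \<inter> X))"
      "\<And>i. \<exists>n. E i (pre (N p) n) = Suc (q i)" using E_run[OF p(1)] by blast
    have "max z 0 < Moo X f x k" using z eff_open_imp_Moo_pos[OF eff X(2) p(2)] by simp
    then obtain s0 where s0: "max z 0 < ereal s0" "cball (f x) s0 \<subseteq> f ` (ball x (inverse (2 ^ k)) \<inter> X)"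
      unfolding Moo_def less_Sup_iff by auto
    obtain s1 where s1: "max z 0 < ereal s1" "s1 < s0" using ereal_dense2[OF s0(1)] by auto
    obtain sc where sc: "s1 < rat_dec sc" "rat_dec sc < s0" using ex_rat_dec_between[OF s1(2)] by blast
    define b where "b j = (vec_dec (fst (prod_decode (q j - 1))) :: real ^ 'm)" for j
    define r where "r j = (if q j = 0 then 0 else rat_dec (snd (prod_decode (q j - 1))))" for j
    have "theta_ball (q j) = ball (b j) (r j)" for j by (simp add: theta_ball_def b_def r_def)
    then have "cball (f x) s0 \<subseteq> (\<Union>j. ball (b j) (r j))" using s0(2) q(1) by (simp add: theta_rep_iff)
    then obtain e where e: "0 < e" "\<And>c. dist (f x) c \<le> s0 \<Longrightarrow> \<exists>j. dist (b j) c + e \<le> r j"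
      by (rule Lebesgue_margin) blast
    \<comment> \<open>The margin \<open>e\<close> must exceed the mesh 2^-a. The fifth is for the
      vectors tested: they lie within \<open>rat_dec sc + 4 * 2^-a\<close> of
      \<open>vec_dec v\<close>, hence within \<open>rat_dec sc + 5 * 2^-a < s0\<close> of
      \<open>f x\<close>, where the Lebesgue margin is available.\<close>
    have "0 < min e ((s0 - rat_dec sc) / 5)" using e(1) sc(2) by simp
    from ex_inverse_power2_less[OF this] obtain a where a: "inverse (2 ^ a) < e" "inverse (2 ^ a) < (s0 - rat_dec sc) / 5"
      by auto
    obtain n' v where v: "fx p a n' = Suc v"
      using F(2)[OF p(2) pair_rep_fstD[OF p(1)], of a] unfolding fx_def by blast
    have vd: "dist (vec_dec v) (f x) < inverse (2 ^ a)"
      using F(3)[OF p(2) pair_rep_fstD[OF p(1)]] v unfolding fx_def by blast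
    obtain K where K: "norm (vec_dec v :: real ^ 'm) + rat_dec sc + 2 < real K"
      using reals_Archimedean2 by blast
    define near where "near c \<longleftrightarrow> dist (vec_dec c :: real ^ 'm) (vec_dec v) < rat_dec sc + 4 * inverse (2 ^ a)" for c
    have "\<exists>m. near c \<longrightarrow> inside p a m c" for c
    proof (cases "near c")
      case True
      have "dist (f x) (vec_dec c) \<le> s0"
        using True vd a(2) dist_triangle[of "f x" "vec_dec c" "vec_dec v"]
        by (simp add: near_def dist_commute)
      then obtain j where j: "dist (b j) (vec_dec c) + e \<le> r j" using e(2) by blast
      have "0 < r j" using j e(1) zero_le_dist[of "b j" "vec_dec c"] by linarith
      then have qj: "q j \<noteq> 0" by (auto simp: r_def split: if_splits)
      obtain m' where m': "E j (pre (N p) m') = Suc (q j)" using q(2) by blast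
      have "inside p a (Suc (max j m')) c"
        unfolding inside_def
      proof (intro exI conjI)
        show "j < Suc (max j m')" "m' < Suc (max j m')" by auto
        show "1 < E j (pre (N p) m')" using m' qj by simp
        have "E j (pre (N p) m') - 2 = q j - 1" using m' by simp
        then show "dist (vec_dec (fst (prod_decode (E j (pre (N p) m') - 2))) :: real ^ 'm) (vec_dec c)
          < rat_dec (snd (prod_decode (E j (pre (N p) m') - 2))) - inverse (2 ^ a)"
          using j qj a(1) by (simp add: b_def r_def)
      qed
      then show ?thesis by blast
    qed simp
    moreover have "near c \<longrightarrow> inside p a m' c" if "near c \<longrightarrow> inside p a m c" "m \<le> m'" for c m m'
      using that unfolding inside_def by (meson less_le_trans)
    ultimately have "\<exists>m. \<forall>c<Suc (grid_bound L (a + CARD('m)) K). near c \<longrightarrow> inside p a m c"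
      by (rule ex_uniform_bound)
    then obtain m where "\<forall>c<Suc (grid_bound L (a + CARD('m)) K). near c \<longrightarrow> inside p a m c" ..
    then have "C p sc a m K n'" using v K by (simp add: C_def near_def)
    moreover have "z < ereal (rat_dec sc)"
      using s1(1) sc(1) by (metis less_ereal.simps(1) less_trans max_less_iff_conj)
    ultimately show ?thesis by blast
  qed
  show ?thesis
    unfolding fn_computable_def
  proof (rule mv_computableI)
    have N': "computable (\<lambda>e. N (nth0 (w e)) (s e))" if "computable w" "computable s"
      for w :: "'e::encodable \<Rightarrow> nat list" and s
      using computable_comp2[OF N(1) that] .
    show "computable (\<lambda>z. G (fst z) (fst (snd z)) (snd (snd z)))"
      unfolding G_def C_def inside_def fx_def guard_def Let_def
      by (intro computable_intros computable_comp2[OF F(1)] computable_comp2[OF E(1)] N')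
  next
    show "\<exists>t n. G i t (pre p n) \<noteq> 0" for p i
      by (rule exI, rule exI[of _ "nth0 (list_decode i) 5"]) (simp add: G_def Let_def)
  next
    fix xk p r assume "xk \<in> X \<times> (UNIV :: nat set)" "pair_rep rho_rep nu_rep p xk"
      and G: "\<And>i. \<exists>t n. G i t (pre p n) = Suc (r i)"
    then obtain x k where xk: "xk = (x, k)" and p: "pair_rep rho_rep nu_rep p (x, k)" "x \<in> X" by auto
    have r: "r i = (let d = nth0 (list_decode i) in
      if guard (d 2) (d 4) (d 5) \<and> C p (d 0) (d 1) (d 2) (d 3) (d 4) then d 0 else 0)" for i
    proof -
      define d where "d = nth0 (list_decode i)"
      obtain t n where "G i t (pre p n) = Suc (r i)" using G by blast
      then have "d 5 \<le> n" "Suc (r i) = (if guard (d 2) (d 4) (d 5) \<and>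
          C (nth0 (pre p n)) (d 0) (d 1) (d 2) (d 3) (d 4) then Suc (d 0) else Suc 0)"
        by (auto simp: G_def Let_def simp flip: d_def split: if_splits)
      then show ?thesis
        using C_local[of "d 2" "d 4" "d 5" n] by (auto simp: Let_def simp flip: d_def split: if_splits)
    qed
    have "ereal (rat_dec (r i)) < Moo X f x k" for i
      using sound[OF p] eff_open_imp_Moo_pos[OF eff X(2) p(2)] by (auto simp: r Let_def zero_ereal_def[symmetric])
    moreover have "\<exists>i. z < ereal (rat_dec (r i))" if "z < Moo X f x k" for z
    proof -
      obtain sc a m K n' where C: "C p sc a m K n'" "z < ereal (rat_dec sc)"
        using complete[OF p \<open>z < Moo X f x k\<close>] by blast
      have "\<exists>n0. \<forall>s<m. 2 * nth0 (list_decode s) 2 < n0"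
        by (rule ex_uniform_bound) (auto intro: lessI less_le_trans)
      then obtain n0 where n0: "\<forall>s<m. 2 * nth0 (list_decode s) 2 < n0" ..
      define n where "n = n0 + 2 * n' + 2"
      have "guard m n' n" using n0 by (auto simp: guard_def n_def)
      with C have "r (list_encode [sc, a, m, K, n', n]) = sc" by (simp add: r nth0_def)
      with C(2) show ?thesis by metis
    qed
    ultimately have "rhol_rep r (Moo X f x k)" by (simp add: rhol_rep_def)
    then show "\<exists>b\<in>{case xk of (x, k) \<Rightarrow> Moo X f x k}. rhol_rep r b" by (simp add: xk)
  qed
qed

section \<open>Assembly of the equivalences\<close>

lemma theta_rep_open: "theta_rep p U \<Longrightarrow> open U"
  by (auto simp: theta_rep_iff theta_ball_def)

theorem theorem2:
  fixes X :: "(real ^ 'n::finite) set"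
  assumes "comp_elem theta_rep X"
  shows
   "(\<forall>(xs :: nat \<Rightarrow> real ^ 'n) (f :: real ^ 'n \<Rightarrow> real ^ 'm::finite).
       fn_computable nu_rep rho_rep UNIV xs \<and> range xs \<subseteq> X \<and> X \<subseteq> closure (range xs) \<longrightarrow>
       (fn_computable rho_rep rho_rep X f \<longleftrightarrow>
          fn_computable nu_rep rho_rep UNIV (\<lambda>j. f (xs j)) \<and>
          (\<exists>moc :: real ^ 'n \<Rightarrow> nat \<Rightarrow> nat set.
             mv_computable (pair_rep rho_rep nu_rep) nu_rep (X \<times> UNIV) (\<lambda>(x, k). moc x k) \<and>
             (\<forall>x\<in>X. \<forall>k. \<forall>l\<in>moc x k.
                f ` (ball x (inverse (2 ^ l)) \<inter> X) \<subseteq> ball (f x) (inverse (2 ^ k)))))) \<and>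
    (\<forall>f :: real ^ 'n \<Rightarrow> real ^ 'm. fn_computable rho_rep rho_rep X f \<longrightarrow>
       (eff_open X f \<longleftrightarrow>
          (\<forall>x\<in>X. \<forall>k. Moo X f x k > 0) \<and>
          fn_computable (pair_rep rho_rep nu_rep) rhol_rep (X \<times> UNIV) (\<lambda>(x, k). Moo X f x k))) \<and>
    (\<forall>f :: real ^ 'n \<Rightarrow> real ^ 'm. fn_computable rho_rep rho_rep X f \<longrightarrow>
       (eff_open X f \<longleftrightarrow>
          (\<exists>moo :: real ^ 'n \<Rightarrow> nat \<Rightarrow> nat set.
             mv_computable (pair_rep rho_rep nu_rep) nu_rep (X \<times> UNIV) (\<lambda>(x, k). moo x k) \<and>
             (\<forall>x\<in>X. \<forall>k. \<forall>l\<in>moo x k.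
                ball (f x) (inverse (2 ^ l)) \<subseteq> f ` (ball x (inverse (2 ^ k)) \<inter> X)))))"
proof -
  have X: "open X" using assms theta_rep_open unfolding comp_elem_def by blast
  \<comment> \<open>The witness is the set of all valid exponents, of which the machine has to find
    only one.\<close>
  have moo: "\<exists>moo :: real ^ 'n \<Rightarrow> nat \<Rightarrow> nat set.
      mv_computable (pair_rep rho_rep nu_rep) nu_rep (X \<times> UNIV) (\<lambda>(x, k). moo x k) \<and>
      (\<forall>x\<in>X. \<forall>k. \<forall>l\<in>moo x k.
        ball (f x) (inverse (2 ^ l)) \<subseteq> f ` (ball x (inverse (2 ^ k)) \<inter> X))"
    if "\<forall>x\<in>X. \<forall>k. Moo X f x k > 0"
      "fn_computable (pair_rep rho_rep nu_rep) rhol_rep (X \<times> UNIV) (\<lambda>(x, k). Moo X f x k)"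
    for f :: "real ^ 'n \<Rightarrow> real ^ 'm"
    using computable_modulus_of_openness[of X f] that
    by (intro exI[of _ "\<lambda>x k. {l. ball (f x) (inverse (2 ^ l)) \<subseteq> f ` (ball x (inverse (2 ^ k)) \<inter> X)}"])
      auto
  have eff: "eff_open X f"
    if "fn_computable rho_rep rho_rep X f" "\<exists>moo :: real ^ 'n \<Rightarrow> nat \<Rightarrow> nat set.
      mv_computable (pair_rep rho_rep nu_rep) nu_rep (X \<times> UNIV) (\<lambda>(x, k). moo x k) \<and>
      (\<forall>x\<in>X. \<forall>k. \<forall>l\<in>moo x k.
        ball (f x) (inverse (2 ^ l)) \<subseteq> f ` (ball x (inverse (2 ^ k)) \<inter> X))"
    for f :: "real ^ 'n \<Rightarrow> real ^ 'm"
    using that eff_open_of_modulus_of_openness[of X f] by blast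
  have Moo: "(\<forall>x\<in>X. \<forall>k. Moo X f x k > 0) \<and>
      fn_computable (pair_rep rho_rep nu_rep) rhol_rep (X \<times> UNIV) (\<lambda>(x, k). Moo X f x k)"
    if "fn_computable rho_rep rho_rep X f" "eff_open X f" for f :: "real ^ 'n \<Rightarrow> real ^ 'm"
    using that computable_Moo_of_eff_open[OF assms X] eff_open_imp_Moo_pos[OF _ X] by blast
  show ?thesis
  proof (intro conjI allI impI iffI)
    fix xs :: "nat \<Rightarrow> real ^ 'n" and f :: "real ^ 'n \<Rightarrow> real ^ 'm"
    assume xs: "fn_computable nu_rep rho_rep UNIV xs \<and> range xs \<subseteq> X \<and> X \<subseteq> closure (range xs)"
    {
      assume f: "fn_computable rho_rep rho_rep X f"
      then show "fn_computable nu_rep rho_rep UNIV (\<lambda>j. f (xs j))"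
        using computable_along_computable_sequence xs by blast
      show "\<exists>moc :: real ^ 'n \<Rightarrow> nat \<Rightarrow> nat set.
        mv_computable (pair_rep rho_rep nu_rep) nu_rep (X \<times> UNIV) (\<lambda>(x, k). moc x k) \<and>
        (\<forall>x\<in>X. \<forall>k. \<forall>l\<in>moc x k.
          f ` (ball x (inverse (2 ^ l)) \<inter> X) \<subseteq> ball (f x) (inverse (2 ^ k)))"
        using computable_modulus_of_continuity[OF f]
        by (intro exI[of _ "\<lambda>x k. {l. f ` (ball x (inverse (2 ^ l)) \<inter> X) \<subseteq> ball (f x) (inverse (2 ^ k))}"])
          auto
    next
      assume a: "fn_computable nu_rep rho_rep UNIV (\<lambda>j. f (xs j)) \<and>
        (\<exists>moc :: real ^ 'n \<Rightarrow> nat \<Rightarrow> nat set.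
          mv_computable (pair_rep rho_rep nu_rep) nu_rep (X \<times> UNIV) (\<lambda>(x, k). moc x k) \<and>
          (\<forall>x\<in>X. \<forall>k. \<forall>l\<in>moc x k.
            f ` (ball x (inverse (2 ^ l)) \<inter> X) \<subseteq> ball (f x) (inverse (2 ^ k))))"
      then obtain moc :: "real ^ 'n \<Rightarrow> nat \<Rightarrow> nat set" where moc:
        "mv_computable (pair_rep rho_rep nu_rep) nu_rep (X \<times> UNIV) (\<lambda>(x, k). moc x k)"
        "\<And>x k l. x \<in> X \<Longrightarrow> l \<in> moc x k \<Longrightarrow>
          f ` (ball x (inverse (2 ^ l)) \<inter> X) \<subseteq> ball (f x) (inverse (2 ^ k))"
        by auto
      show "fn_computable rho_rep rho_rep X f"
        using xs a by (intro computable_of_modulus_of_continuity[of xs X f moc] moc) auto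
    }
  qed (use Moo moo eff in blast)+
qed

end
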